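(* Let $i_0(x,y)=(y,x)$. Each of the following four is an $i_0$-symmetric flow of level $1$ (i.e. a flow $\phi$ of level $1$ with $i_0\circ\phi\circ i_0=\phi$): $$\phi_{\mathrm{tor},1}(x,y)=\Big(\frac{x}{x+1},\ \frac{y}{y+1}\Big),$$ $$\Phi_1(x,y)=\Big(\frac{(x+y)^2+2x}{2(x+y+1)^2},\ \frac{(x+y)^2+2y}{2(x+y+1)^2}\Big),$$ $$\Phi_1'(x,y)=\Big(\frac{x^2-y^2+2x}{2(x+y+1)},\ \frac{y^2-x^2+2y}{2(x+y+1)}\Big),$$ $$\Psi(x,y)=\Big(\frac{2x^2y(x+y)+(x-y)^2x}{(y-x)(x^2+xy-x+y)},\ \frac{2xy^2(x+y)+(x-y)^2y}{(x-y)(y^2+xy-y+x)}\Big).$$ Every $i_0$-symmetric flow of level $1$ is of the form $\ell^{-1}\circ\phi\circ\ell$, where $\phi$ is one of these four flows and $\ell(x,y)=(xA(x,y),yA(x,y))$ for some non-zero $0$-homogeneous rational function $A\in\mathbb{R}(x,y)$ with $A(x,y)=A(y,x)$.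
   Context: A flow is a pair $\phi=(u,v)$ of rational functions in $\mathbb{R}(x,y)$, $\phi\ne(x,y)$, satisfying, as identities of rational functions, $(1-z)\phi(\mathbf{x})=\phi\big(\phi(\mathbf{x}z)\frac{1-z}{z}\big)$ and $\lim_{z\to0}\phi(\mathbf{x}z)/z=\mathbf{x}$, where $\mathbf{x}=(x,y)$. A $1$-BIR is a birational plane transformation over $\mathbb{R}$ whose two coordinates are homogeneous rational functions of degree $1$. A flow $\phi$ has level $1$ if $\phi=\ell^{-1}\circ\phi_1\circ\ell$ for some $1$-BIR $\ell$, where $\phi_1(x,y)=\big(x,\frac{y}{y+1}\big)$. $0$-homogeneous means homogeneous of degree $0$. *)

theory Defs
  imports "HOL-Computational_Algebra.Computational_Algebra" "HOL-Computational_Algebra.Field_as_Ring"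
    Complex_Main
begin

text \<open>\<open>\<real>[x,y] = \<real>[x][y]\<close> is modelled as \<^typ>\<open>real poly poly\<close>: the inner
  variable is \<open>x\<close>, the outer one is \<open>y\<close>.\<close>

type_synonym ratfun = "real poly poly fract"
type_synonym ratmap = "ratfun \<times> ratfun"

definition varX :: ratfun where "varX = to_fract [:[:0, 1:]:]"
definition varY :: ratfun where "varY = to_fract [:0, 1:]"

text \<open>Value of a polynomial and of a rational function at a point \<open>(a, b)\<close> of \<open>K \<times> K\<close>, for a
  field \<open>K\<close> and an embedding \<open>h\<close> of the reals into \<open>K\<close>.\<close>

definition eval_pol :: "(real \<Rightarrow> 'k::field) \<Rightarrow> real poly poly \<Rightarrow> 'k \<Rightarrow> 'k \<Rightarrow> 'k" where
  "eval_pol h p a b = poly (map_poly (\<lambda>c. poly (map_poly h c) a) p) b"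

text \<open>Numerator and denominator are taken in lowest terms, so that the value is defined as soon
  as some representation of the rational function has a denominator that does not vanish at
  \<open>(a, b)\<close>, and it can be computed from any such representation (lemma \<open>eval_rf_Fract\<close>).
  Where the value is undefined, \<open>eval_rf\<close> is \<open>0\<close>.\<close>

definition defined_rf :: "(real \<Rightarrow> 'k::field) \<Rightarrow> ratfun \<Rightarrow> 'k \<Rightarrow> 'k \<Rightarrow> bool" where
  "defined_rf h f a b \<longleftrightarrow> eval_pol h (snd (quot_of_fract f)) a b \<noteq> 0"

definition eval_rf :: "(real \<Rightarrow> 'k::field) \<Rightarrow> ratfun \<Rightarrow> 'k \<Rightarrow> 'k \<Rightarrow> 'k" where
  "eval_rf h f a b =
     eval_pol h (fst (quot_of_fract f)) a b / eval_pol h (snd (quot_of_fract f)) a b"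

lemma map_poly_mult_hom:
  assumes "\<And>x y. h (x + y) = h x + h y" "\<And>x y. h (x * y) = h x * h y" "h 0 = 0"
  shows "map_poly h (p * q) = map_poly h p * map_poly h (q :: 'a::comm_semiring_0 poly)"
proof -
  have s: "h (sum f A) = (\<Sum>i\<in>A. h (f i))" if "finite A" for f :: "nat \<Rightarrow> 'a" and A
    using that by (induction A rule: finite_induct) (simp_all add: assms)
  show ?thesis
    by (rule poly_eqI) (simp add: coeff_map_poly coeff_mult assms s)
qed

lemma eval_pol_mult:
  assumes "\<And>x y. h (x + y) = h x + h y" "\<And>x y. h (x * y) = h x * h y" "h 0 = 0"
  shows "eval_pol h (p * q) a b = eval_pol h p a b * eval_pol h q a b"
proof -
  let ?g = "\<lambda>c. poly (map_poly h c) a"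
  have "map_poly h (c + d) = map_poly h c + map_poly h d" for c d
    by (rule poly_eqI) (simp add: coeff_map_poly assms)
  hence "?g (c + d) = ?g c + ?g d" for c d by simp
  moreover have "?g (c * d) = ?g c * ?g d" for c d
    by (simp add: map_poly_mult_hom assms)
  ultimately have "map_poly ?g (p * q) = map_poly ?g p * map_poly ?g q"
    by (intro map_poly_mult_hom) simp_all
  thus ?thesis by (simp add: eval_pol_def)
qed

lemma eval_rf_Fract:
  assumes h: "\<And>x y. h (x + y) = h x + h y" "\<And>x y. h (x * y) = h x * h y" "h 0 = 0"
    and nz: "eval_pol h q a b \<noteq> 0"
  shows "defined_rf h (Fract p q) a b"
    and "eval_rf h (Fract p q) a b = eval_pol h p a b / eval_pol h q a b"
proof -
  have "q \<noteq> 0" using nz by (auto simp: eval_pol_def)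
  then obtain d where "p = fst (normalize_quot (p, q)) * d" "q = snd (normalize_quot (p, q)) * d"
    by (rule normalize_quotE)
  moreover have "quot_of_fract (Fract p q) = normalize_quot (p, q)"
    using quot_of_fract_quot_to_fract[of "(p, q)"] by (simp add: quot_to_fract_def)
  ultimately obtain r s where rs: "quot_of_fract (Fract p q) = (r, s)" "p = r * d" "q = s * d"
    by (cases "normalize_quot (p, q)") auto
  have e: "eval_pol h p a b = eval_pol h r a b * eval_pol h d a b"
    "eval_pol h q a b = eval_pol h s a b * eval_pol h d a b"
    unfolding rs(2,3) by (simp_all add: eval_pol_mult h)
  show "defined_rf h (Fract p q) a b"
    "eval_rf h (Fract p q) a b = eval_pol h p a b / eval_pol h q a b"
    using nz unfolding defined_rf_def eval_rf_def rs(1) e by auto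
qed

definition const_rf :: "real \<Rightarrow> ratfun" where
  "const_rf c = to_fract [:[:c:]:]"

definition subst_rf :: "ratfun \<Rightarrow> ratmap \<Rightarrow> ratfun" where
  "subst_rf f \<psi> = eval_rf const_rf f (fst \<psi>) (snd \<psi>)"

definition id_rm :: ratmap where "id_rm = (varX, varY)"

definition comp_rm :: "ratmap \<Rightarrow> ratmap \<Rightarrow> ratmap" (infixr "\<circ>\<^sub>r" 55) where
  "\<phi> \<circ>\<^sub>r \<psi> = (subst_rf (fst \<phi>) \<psi>, subst_rf (snd \<phi>) \<psi>)"

definition composable :: "ratmap \<Rightarrow> ratmap \<Rightarrow> bool" where
  "composable \<phi> \<psi> \<longleftrightarrow> defined_rf const_rf (fst \<phi>) (fst \<psi>) (snd \<psi>)
                   \<and> defined_rf const_rf (snd \<phi>) (fst \<psi>) (snd \<psi>)"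

definition inverse_rm :: "ratmap \<Rightarrow> ratmap \<Rightarrow> bool" where
  "inverse_rm \<phi> \<psi> \<longleftrightarrow> composable \<phi> \<psi> \<and> \<phi> \<circ>\<^sub>r \<psi> = id_rm \<and> composable \<psi> \<phi> \<and> \<psi> \<circ>\<^sub>r \<phi> = id_rm"

definition birational :: "ratmap \<Rightarrow> bool" where
  "birational \<phi> \<longleftrightarrow> (\<exists>\<psi>. inverse_rm \<phi> \<psi>)"

text \<open>\<open>conjugate_rm l \<phi> \<psi>\<close>: the map \<open>l\<close> is birational and \<open>\<psi> = l\<^sup>-\<^sup>1 \<circ> \<phi> \<circ> l\<close>.\<close>

definition conjugate_rm :: "ratmap \<Rightarrow> ratmap \<Rightarrow> ratmap \<Rightarrow> bool" where
  "conjugate_rm l \<phi> \<psi> \<longleftrightarrow> (\<exists>m. inverse_rm l m \<and>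
     composable \<phi> l \<and> composable m (\<phi> \<circ>\<^sub>r l) \<and> \<psi> = m \<circ>\<^sub>r \<phi> \<circ>\<^sub>r l)"

text \<open>Identities involving a third variable \<open>z\<close> are identities in \<open>\<real>(x,y)(z) = \<real>(x,y,z)\<close>.\<close>

type_synonym ratfun3 = "ratfun poly fract"

definition varZ :: ratfun3 where "varZ = to_fract [:0, 1:]"
definition lift3 :: "ratfun \<Rightarrow> ratfun3" where "lift3 f = to_fract [:f:]"
definition const3 :: "real \<Rightarrow> ratfun3" where "const3 c = lift3 (const_rf c)"

text \<open>\<open>f(xz, yz)\<close>; the denominator never vanishes at \<open>(xz, yz)\<close>, so this is always defined.\<close>

definition scale_rf :: "ratfun \<Rightarrow> ratfun3" where
  "scale_rf f = eval_rf const3 f (lift3 varX * varZ) (lift3 varY * varZ)"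

definition homogeneous :: "nat \<Rightarrow> ratfun \<Rightarrow> bool" where
  "homogeneous d f \<longleftrightarrow> scale_rf f = varZ ^ d * lift3 f"

definition one_BIR :: "ratmap \<Rightarrow> bool" where
  "one_BIR l \<longleftrightarrow> birational l \<and> homogeneous 1 (fst l) \<and> homogeneous 1 (snd l)"

definition flow_equation :: "ratmap \<Rightarrow> bool" where
  "flow_equation \<phi> \<longleftrightarrow>
     (let a = scale_rf (fst \<phi>) * ((1 - varZ) / varZ);
          b = scale_rf (snd \<phi>) * ((1 - varZ) / varZ)
      in defined_rf const3 (fst \<phi>) a b \<and> defined_rf const3 (snd \<phi>) a b
       \<and> (1 - varZ) * lift3 (fst \<phi>) = eval_rf const3 (fst \<phi>) a b
       \<and> (1 - varZ) * lift3 (snd \<phi>) = eval_rf const3 (snd \<phi>) a b)"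

text \<open>The condition \<open>lim\<^bsub>z\<rightarrow>0\<^esub> \<phi>(xz, yz)/z = (x, y)\<close> is an identity of rational functions:
  it is required at all real points \<open>(x, y)\<close> off the zero set of some nonzero polynomial. (At
  a special point the map may be undefined along the whole line through it and the origin.)\<close>

definition eval_real :: "ratfun \<Rightarrow> real \<Rightarrow> real \<Rightarrow> real" where
  "eval_real f x y = eval_rf (\<lambda>c. c) f x y"

definition flow_limit :: "ratmap \<Rightarrow> bool" where
  "flow_limit \<phi> \<longleftrightarrow> (\<exists>D :: real poly poly. D \<noteq> 0 \<and>
     (\<forall>x y. eval_pol (\<lambda>c. c) D x y \<noteq> 0 \<longrightarrow>
        (\<forall>\<^sub>F z in at 0. defined_rf (\<lambda>c. c) (fst \<phi>) (x * z) (y * z) \<and>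
                       defined_rf (\<lambda>c. c) (snd \<phi>) (x * z) (y * z)) \<and>
        ((\<lambda>z. (eval_real (fst \<phi>) (x * z) (y * z) / z, eval_real (snd \<phi>) (x * z) (y * z) / z))
           \<longlongrightarrow> (x, y)) (at 0)))"

definition is_flow :: "ratmap \<Rightarrow> bool" where
  "is_flow \<phi> \<longleftrightarrow> \<phi> \<noteq> id_rm \<and> flow_equation \<phi> \<and> flow_limit \<phi>"

definition phi_one :: ratmap where
  "phi_one = (varX, varY / (varY + 1))"

definition flow_level_one :: "ratmap \<Rightarrow> bool" where
  "flow_level_one \<phi> \<longleftrightarrow> is_flow \<phi> \<and> (\<exists>l. one_BIR l \<and> conjugate_rm l phi_one \<phi>)"

definition i0 :: ratmap where "i0 = (varY, varX)"

definition i0_symmetric :: "ratmap \<Rightarrow> bool" where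
  "i0_symmetric \<phi> \<longleftrightarrow> i0 \<circ>\<^sub>r \<phi> \<circ>\<^sub>r i0 = \<phi>"

definition phi_tor1 :: ratmap where
  "phi_tor1 = (let x = varX; y = varY in (x / (x + 1), y / (y + 1)))"

definition Phi1 :: ratmap where
  "Phi1 = (let x = varX; y = varY in
     (((x + y)^2 + 2 * x) / (2 * (x + y + 1)^2),
      ((x + y)^2 + 2 * y) / (2 * (x + y + 1)^2)))"

definition Phi1' :: ratmap where
  "Phi1' = (let x = varX; y = varY in
     ((x^2 - y^2 + 2 * x) / (2 * (x + y + 1)),
      (y^2 - x^2 + 2 * y) / (2 * (x + y + 1))))"

definition Psi :: ratmap where
  "Psi = (let x = varX; y = varY in
     ((2 * x^2 * y * (x + y) + (x - y)^2 * x) / ((y - x) * (x^2 + x * y - x + y)),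
      (2 * x * y^2 * (x + y) + (x - y)^2 * y) / ((x - y) * (y^2 + x * y - y + x))))"

end

theory Submission
  imports Defs
begin

text \<open>Write \<open>K = \<real>(x, y)\<close>, and let \<open>l = (P, Q)\<close> be a 1-BIR that conjugates a flow \<open>\<psi>\<close> to
\<open>(x, y / (y + 1))\<close>. This says that composition with \<open>\<psi>\<close> fixes \<open>P\<close> and sends \<open>1 / Q\<close> to
\<open>1 / Q + 1\<close>. The classification works entirely with these two relations in \<open>K\<close>.

A 0-homogeneous function that is invariant under \<open>\<psi>\<close> is constant: it is rational in \<open>t = Q / P\<close>, and
\<open>\<psi>\<close> replaces \<open>t\<close> by \<open>t / (Q + 1)\<close>, where \<open>t\<close> and \<open>Q\<close> are algebraically independent
(\<open>homogeneous_0_rational_in_quotient\<close>, \<open>invariant_constant\<close>). Let \<open>\<sigma>\<close> exchange \<open>x\<close> and \<open>y\<close>. If \<open>\<psi>\<close> is symmetric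
then \<open>\<sigma>\<close> commutes with \<open>\<psi>\<close>, so \<open>\<sigma>P / P\<close> and \<open>P / \<sigma>Q - P / Q\<close> are invariant, hence constants \<open>c\<close> and \<open>d\<close>.
From \<open>\<sigma>\<^sup>2 = 1\<close> one gets \<open>c\<^sup>2 = 1\<close> and \<open>(c + 1) d = 0\<close>; for \<open>c = 1\<close> the map \<open>\<sigma>\<close> would be trivial on
\<open>\<real>(P, Q) = K\<close>. So \<open>\<sigma>P = - P\<close>, and \<open>r = P / Q + d / 2\<close> is \<open>\<sigma>\<close>-odd.

The fields generated by \<open>t = Q / P\<close>, by \<open>s = (x - y) / (x + y)\<close> and by \<open>y / x\<close> all consist of the 0-homogeneous
functions. Hence \<open>t\<close>, and with it \<open>r\<close>, is a Moebius function of \<open>s\<close>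
(\<open>moebius_if_mutually_rational\<close>). As \<open>r\<close> and \<open>s\<close> are both odd, \<open>r = k s\<close> or \<open>r = k / s\<close>
(\<open>odd_moebius\<close>). With \<open>R = P / r\<close> and \<open>A = R / (x + y)\<close>, which is symmetric, the flow \<open>\<psi>\<close> acts on \<open>(x + y) A = R\<close> by
\<open>R / (R + 1)\<close>, and on \<open>U = (x - y) A = s R\<close> by \<open>U\<close> in the first case and by \<open>U / (R + 1)\<^sup>2\<close> in the second.
These are the actions of \<open>Phi1'\<close> and \<open>Phi1\<close> on \<open>x + y\<close> and \<open>x - y\<close>
(\<open>symmetric_level_one_classification\<close>). So two of the four normal forms already reach every symmetric flow of
level 1; each of the other two lies in the orbit of one of them.

Conversely, every conjugate of \<open>(x, y / (y + 1))\<close> by a 1-BIR satisfies the flow equation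
(\<open>flow_equation_conjugate_phi_one\<close>). It remains to exhibit the conjugating maps of the four flows and to compute
the limits at \<open>z = 0\<close>.

Compositions are defined only where denominators do not vanish. All such questions are
reduced to generic points, that is, pairs of algebraically independent elements of a field: there every
rational function has a value, and evaluation is a homomorphism of fields.\<close>

section \<open>Ring homomorphisms and evaluation of polynomials\<close>

locale rhom =
  fixes h :: "'a::comm_ring_1 \<Rightarrow> 'b::comm_ring_1"
  assumes add: "h (x + y) = h x + h y"
    and mult: "h (x * y) = h x * h y"
    and one: "h 1 = 1"
begin

lemma zero: "h 0 = 0"
  using add[of 0 0] by simp

lemma uminus: "h (- x) = - h x"
  using add[of x "- x"] by (simp add: zero add_eq_0_iff)

lemma diff: "h (x - y) = h x - h y"
  using add[of x "- y"] by (simp add: uminus)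

lemma power: "h (x ^ n) = h x ^ n"
  by (induction n) (simp_all add: one mult)

lemma numeral: "h (numeral n) = numeral n"
proof -
  have "h (of_nat k) = of_nat k" for k
    by (induction k) (simp_all add: zero one add)
  from this[of "numeral n"] show ?thesis by simp
qed

lemmas simps = add mult one zero uminus diff power numeral

lemma poly: "h (poly p a) = poly (map_poly h p) (h a)"
  by (induction p) (simp_all add: map_poly_pCons simps)

end

lemma rhom_inverse:
  fixes h :: "'a::field \<Rightarrow> 'b::field"
  assumes "rhom h"
  shows "h (inverse x) = inverse (h x)"
proof (cases "x = 0")
  case False
  have "h x * h (inverse x) = 1"
    by (metis False assms right_inverse rhom.mult rhom.one)
  thus ?thesis by (simp add: inverse_unique)
qed (simp add: rhom.zero[OF assms])

lemma rhom_divide: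
  fixes h :: "'a::field \<Rightarrow> 'b::field"
  assumes "rhom h"
  shows "h (x / y) = h x / h y"
  by (simp add: divide_inverse rhom.mult[OF assms] rhom_inverse[OF assms])

lemma rhom_eq_0_iff:
  fixes h :: "'a::field \<Rightarrow> 'b::field"
  assumes "rhom h"
  shows "h x = 0 \<longleftrightarrow> x = 0"
  by (metis assms rhom.mult rhom.one rhom.zero right_inverse mult_zero_left zero_neq_one)

lemma rhom_eq_iff:
  fixes h :: "'a::field \<Rightarrow> 'b::field"
  assumes "rhom h"
  shows "h x = h y \<longleftrightarrow> x = y"
  using rhom_eq_0_iff[OF assms, of "x - y"] by (simp add: rhom.diff[OF assms])

lemma rhom_comp:
  assumes "rhom g" "rhom h"
  shows "rhom (\<lambda>x. g (h x))"
  using assms by (simp add: rhom_def)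

lemma rhom_id: "rhom (\<lambda>x. x)"
  by (simp add: rhom_def)

lemma rhom_const_poly: "rhom (\<lambda>c. [:c:])"
  by unfold_locales (simp_all add: one_pCons)

lemma rhom_to_fract: "rhom to_fract"
  by unfold_locales simp_all

lemma rhom_map_poly:
  assumes "rhom h"
  shows "rhom (map_poly h)"
proof -
  interpret rhom h by fact
  show ?thesis
    by unfold_locales
      (simp_all add: map_poly_mult_hom simps poly_eq_iff coeff_map_poly)
qed

lemma rhom_poly: "rhom (\<lambda>p. poly p a)"
  by unfold_locales simp_all

lemma rhom_eval1:
  assumes "rhom h"
  shows "rhom (\<lambda>p. poly (map_poly h p) a)"
  by (rule rhom_comp[OF rhom_poly rhom_map_poly[OF assms]])

text \<open>The same formula as \<^const>\<open>eval_pol\<close>, but with values in a commutative ring. Evaluating in the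
polynomial ring \<open>K[z]\<close> makes it possible to specialise \<open>z\<close> afterwards to an arbitrary element of \<open>K\<close>.\<close>

definition eval2 :: "(real \<Rightarrow> 'k::comm_ring_1) \<Rightarrow> real poly poly \<Rightarrow> 'k \<Rightarrow> 'k \<Rightarrow> 'k" where
  "eval2 h p a b = poly (map_poly (\<lambda>c. poly (map_poly h c) a) p) b"

lemma eval_pol_eval2: "eval_pol h p a b = eval2 h p a b"
  by (simp add: eval_pol_def eval2_def)

lemma rhom_eval2: "rhom h \<Longrightarrow> rhom (\<lambda>p. eval2 h p a b)"
  unfolding eval2_def by (intro rhom_eval1)

text \<open>A polynomial ring is generated by its constants and the indeterminate.\<close>

lemma rhom_poly_ext:
  assumes "rhom g" "rhom h" and "\<And>c. g [:c:] = h [:c:]" and "g [:0, 1:] = h [:0, 1:]"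
  shows "g p = h p"
proof -
  interpret g: rhom g by fact
  interpret h: rhom h by fact
  show ?thesis
  proof (induction p)
    case (pCons c p)
    have "pCons c p = [:c:] + [:0, 1:] * p" by simp
    thus ?case by (simp only: g.simps h.simps assms(3,4) pCons.IH)
  qed (simp add: g.zero h.zero)
qed

lemma rhom_poly2_ext:
  assumes "rhom g" "rhom h" and "\<And>c. g [:[:c:]:] = h [:[:c:]:]"
    and "g [:[:0, 1:]:] = h [:[:0, 1:]:]" and "g [:0, 1:] = h [:0, 1:]"
  shows "g p = h p"
proof -
  have "g [:c:] = h [:c:]" for c
    using rhom_poly_ext[OF rhom_comp[OF assms(1) rhom_const_poly] rhom_comp[OF assms(2) rhom_const_poly]]
      assms(3,4) by blast
  from rhom_poly_ext[OF assms(1,2) this assms(5)] show ?thesis .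
qed

lemma eval2_hom:
  assumes "rhom H" "rhom h"
  shows "H (eval2 h p a b) = eval2 (\<lambda>c. H (h c)) p (H a) (H b)"
proof -
  interpret H: rhom H by fact
  interpret h: rhom h by fact
  show ?thesis
    unfolding eval2_def H.poly
    by (intro arg_cong2[where f = poly] refl poly_eqI)
      (simp add: coeff_map_poly H.poly H.simps h.simps map_poly_map_poly o_def)
qed

lemma eval2_simps [simp]:
  assumes "rhom h"
  shows "eval2 h [:[:c:]:] a b = h c" "eval2 h [:[:0, 1:]:] a b = a" "eval2 h [:0, 1:] a b = b"
  using assms by (simp_all add: eval2_def map_poly_pCons rhom.simps)

lemma rhom_const_rf: "rhom const_rf"
  unfolding const_rf_def
  by (intro rhom_comp[OF rhom_to_fract] rhom_comp[OF rhom_const_poly] rhom_const_poly)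

lemma rhom_lift3: "rhom lift3"
  unfolding lift3_def by (intro rhom_comp[OF rhom_to_fract] rhom_const_poly)

lemma rhom_const3: "rhom const3"
  unfolding const3_def by (intro rhom_comp[OF rhom_lift3] rhom_const_rf)

lemma to_fract_eq_eval2: "to_fract p = eval2 const_rf p varX varY"
  by (rule rhom_poly2_ext[OF rhom_to_fract rhom_eval2[OF rhom_const_rf]])
    (simp_all add: rhom_const_rf const_rf_def varX_def varY_def)

section \<open>Values of fractions at a place\<close>

text \<open>The local ring of a homomorphism \<open>ev\<close> from a domain into a field: \<open>f\<close> has the value \<open>v\<close> if some
representation of \<open>f\<close> has a denominator that \<open>ev\<close> does not kill. Any representation is admitted, so the
arithmetic rules below need no cancellation. The homomorphism is evaluation of real polynomials in
two variables at a point, or of polynomials over \<open>K\<close> at an element of \<open>K\<close>.\<close>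

definition value_at :: "('r::idom \<Rightarrow> 'k::field) \<Rightarrow> 'r fract \<Rightarrow> 'k \<Rightarrow> bool" where
  "value_at ev f v \<longleftrightarrow> (\<exists>p q. f = Fract p q \<and> ev q \<noteq> 0 \<and> v = ev p / ev q)"

context
  fixes ev :: "'r::idom \<Rightarrow> 'k::field"
  assumes ev: "rhom ev"
begin

interpretation E: rhom ev by (rule ev)

lemma value_at_unique:
  assumes "value_at ev f v" "value_at ev f w"
  shows "v = w"
proof -
  obtain p q r s where *: "f = Fract p q" "ev q \<noteq> 0" "v = ev p / ev q"
    "f = Fract r s" "ev s \<noteq> 0" "w = ev r / ev s"
    using assms unfolding value_at_def by blast
  have "q \<noteq> 0" "s \<noteq> 0" using *(2,5) E.zero by auto
  hence "p * s = r * q" using *(1,4) by (simp add: eq_fract)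
  hence "ev p * ev s = ev r * ev q" by (simp flip: E.mult)
  thus ?thesis using * by (simp add: frac_eq_eq)
qed

lemma value_at_to_fract: "value_at ev (to_fract p) (ev p)"
  unfolding value_at_def
  by (rule exI[of _ p], rule exI[of _ 1]) (simp add: to_fract_def E.one)

lemma value_at_add: "value_at ev f u \<Longrightarrow> value_at ev g v \<Longrightarrow> value_at ev (f + g) (u + v)"
  unfolding value_at_def
proof (elim exE conjE)
  fix p q r s assume *: "f = Fract p q" "ev q \<noteq> 0" "u = ev p / ev q"
    "g = Fract r s" "ev s \<noteq> 0" "v = ev r / ev s"
  hence "q \<noteq> 0" "s \<noteq> 0" using E.zero by auto
  thus "\<exists>p q. f + g = Fract p q \<and> ev q \<noteq> 0 \<and> u + v = ev p / ev q"
    using * by (intro exI[of _ "p * s + r * q"] exI[of _ "q * s"])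
      (simp add: E.mult E.add add_frac_eq)
qed

lemma value_at_mult: "value_at ev f u \<Longrightarrow> value_at ev g v \<Longrightarrow> value_at ev (f * g) (u * v)"
  unfolding value_at_def
proof (elim exE conjE)
  fix p q r s assume *: "f = Fract p q" "ev q \<noteq> 0" "u = ev p / ev q"
    "g = Fract r s" "ev s \<noteq> 0" "v = ev r / ev s"
  thus "\<exists>p q. f * g = Fract p q \<and> ev q \<noteq> 0 \<and> u * v = ev p / ev q"
    by (intro exI[of _ "p * r"] exI[of _ "q * s"]) (simp add: E.mult)
qed

lemma value_at_inverse: "value_at ev f u \<Longrightarrow> u \<noteq> 0 \<Longrightarrow> value_at ev (inverse f) (inverse u)"
  unfolding value_at_def
proof (elim exE conjE)
  fix p q assume *: "f = Fract p q" "ev q \<noteq> 0" "u = ev p / ev q" "u \<noteq> 0"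
  thus "\<exists>p q. inverse f = Fract p q \<and> ev q \<noteq> 0 \<and> inverse u = ev p / ev q"
    by (intro exI[of _ q] exI[of _ p]) auto
qed

lemma value_at_0: "value_at ev 0 0"
  using value_at_to_fract[of 0] by (simp add: E.zero)

lemma value_at_1: "value_at ev 1 1"
  using value_at_to_fract[of 1] by (simp add: E.one)

lemma value_at_numeral: "value_at ev (numeral n) (numeral n)"
  using value_at_to_fract[of "numeral n"] by (simp add: E.numeral rhom.numeral[OF rhom_to_fract])

lemma value_at_uminus: "value_at ev f u \<Longrightarrow> value_at ev (- f) (- u)"
  using value_at_mult[OF value_at_to_fract[of "- 1"], of f u] by (simp add: E.uminus E.one)

lemma value_at_diff: "value_at ev f u \<Longrightarrow> value_at ev g v \<Longrightarrow> value_at ev (f - g) (u - v)"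
  using value_at_add[of f u "- g" "- v"] value_at_uminus by simp

lemma value_at_divide:
  "value_at ev f u \<Longrightarrow> value_at ev g v \<Longrightarrow> v \<noteq> 0 \<Longrightarrow> value_at ev (f / g) (u / v)"
  by (simp add: divide_inverse value_at_mult value_at_inverse)

lemma value_at_power: "value_at ev f u \<Longrightarrow> value_at ev (f ^ n) (u ^ n)"
  by (induction n) (auto intro: value_at_1 value_at_mult)

lemmas value_at_intros = value_at_0 value_at_1 value_at_numeral value_at_add value_at_diff
  value_at_mult value_at_uminus value_at_divide value_at_power

lemma value_at_poly:
  assumes "rhom k" "rhom h" "\<And>c. value_at ev (k c) (h c)" "value_at ev u v"
  shows "value_at ev (poly (map_poly k p) u) (poly (map_poly h p) v)"
  by (induction p)
    (auto simp: map_poly_pCons rhom.zero[OF assms(1)] rhom.zero[OF assms(2)]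
      intro!: value_at_intros assms)

text \<open>Specialisation commutes with substitution into polynomials; this is how algebraic independence
is lifted from a residue field.\<close>

lemma value_at_eval2:
  assumes "rhom k" "rhom h" "\<And>c. value_at ev (k c) (h c)" "value_at ev u1 v1" "value_at ev u2 v2"
  shows "value_at ev (eval2 k p u1 u2) (eval2 h p v1 v2)"
  unfolding eval2_def using assms
  by (intro value_at_poly rhom_eval1)

end

text \<open>\<open>takes h f a b v\<close> combines \<^const>\<open>defined_rf\<close> and \<^const>\<open>eval_rf\<close> in one relation
(lemma \<open>takes_iff\<close>), so that a value and its existence are computed together, by the rules
\<open>takes_intros\<close>.\<close>

definition takes :: "(real \<Rightarrow> 'k::field) \<Rightarrow> ratfun \<Rightarrow> 'k \<Rightarrow> 'k \<Rightarrow> 'k \<Rightarrow> bool" where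
  "takes h f a b v \<longleftrightarrow> value_at (\<lambda>p. eval2 h p a b) f v"

context
  fixes h :: "real \<Rightarrow> 'k::field"
  assumes h: "rhom h"
begin

lemma takes_iff: "takes h f a b v \<longleftrightarrow> defined_rf h f a b \<and> eval_rf h f a b = v"
proof
  assume "takes h f a b v"
  then obtain p q where "f = Fract p q" "eval2 h q a b \<noteq> 0" "v = eval2 h p a b / eval2 h q a b"
    unfolding takes_def value_at_def by blast
  with eval_rf_Fract[of h q a b p] show "defined_rf h f a b \<and> eval_rf h f a b = v"
    by (simp add: eval_pol_eval2 rhom.simps[OF h])
next
  assume *: "defined_rf h f a b \<and> eval_rf h f a b = v"
  obtain p q where pq: "quot_of_fract f = (p, q)" by (cases "quot_of_fract f")
  hence "f = Fract p q" using quot_to_fract_quot_of_fract[of f] by (simp add: quot_to_fract_def)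
  thus "takes h f a b v"
    using * pq by (auto simp: takes_def value_at_def defined_rf_def eval_rf_def eval_pol_eval2)
qed

lemma takes_eval: "takes h f a b v \<Longrightarrow> eval_rf h f a b = v"
  by (simp add: takes_iff)

lemma takes_unique: "takes h f a b v \<Longrightarrow> takes h f a b w \<Longrightarrow> v = w"
  by (simp add: takes_iff)

lemma takes_to_fract: "takes h (to_fract p) a b (eval2 h p a b)"
  unfolding takes_def by (rule value_at_to_fract[OF rhom_eval2[OF h]])

lemma takes_const: "takes h (const_rf c) a b (h c)"
  and takes_X: "takes h varX a b a"
  and takes_Y: "takes h varY a b b"
  using takes_to_fract[of "[:[:c:]:]"] takes_to_fract[of "[:[:0, 1:]:]"] takes_to_fract[of "[:0, 1:]"]
  by (simp_all add: const_rf_def varX_def varY_def h)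

lemmas takes_intros = takes_const takes_X takes_Y
  value_at_intros[OF rhom_eval2[OF h], folded takes_def]

lemmas takes_mult = value_at_mult[OF rhom_eval2[OF h], folded takes_def]
  and takes_inverse = value_at_inverse[OF rhom_eval2[OF h], folded takes_def]

lemma takes_poly:
  "takes h u a b v \<Longrightarrow> takes h (poly (map_poly const_rf q) u) a b (poly (map_poly h q) v)"
  using takes_const unfolding takes_def
  by (intro value_at_poly rhom_eval2 rhom_const_rf h)

end

lemma takes_0: "rhom h \<Longrightarrow> takes h 0 a b 0"
  by (rule takes_intros)

section \<open>Generic points\<close>

text \<open>A generic point is a point of the plane whose coordinates are algebraically independent over \<open>\<real>\<close>. No
denominator vanishes there.\<close>

definition generic :: "(real \<Rightarrow> 'k::field) \<Rightarrow> 'k \<Rightarrow> 'k \<Rightarrow> bool" where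
  "generic h a b \<longleftrightarrow> (\<forall>p. eval2 h p a b = 0 \<longrightarrow> p = 0)"

text \<open>An algebraic relation between elements specialises to the same relation between their
values, so elements with independent values are independent.\<close>

lemma generic_of_value_at:
  assumes "rhom ev" "rhom k" "rhom h" "\<And>c. value_at ev (k c) (h c)"
    and "value_at ev a a'" "value_at ev b b'" "generic h a' b'"
  shows "generic k a b"
  unfolding generic_def
proof safe
  fix p assume "eval2 k p a b = 0"
  hence "value_at ev 0 (eval2 h p a' b')"
    using value_at_eval2[OF assms(1-6), of p] by simp
  hence "eval2 h p a' b' = 0"
    using value_at_unique[OF assms(1)] value_at_0[OF assms(1)] by blast
  thus "p = 0" using assms(7) by (simp add: generic_def)
qed

lemma generic_takes:
  assumes "rhom h" "generic h a b"
  shows "takes h f a b (eval_rf h f a b)"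
  using assms(2) snd_quot_of_fract_nonzero[of f]
  by (auto simp: takes_iff[OF assms(1)] defined_rf_def generic_def eval_pol_eval2)

lemma rhom_eval_rf:
  assumes h: "rhom h" and g: "generic h a b"
  shows "rhom (\<lambda>f. eval_rf h f a b)"
  by unfold_locales (intro takes_eval[OF h] takes_intros[OF h] generic_takes[OF h g])+

text \<open>This holds even where the value is undefined: a homomorphism of fields is injective, so it maps the
vanishing denominator to \<open>0\<close>, and division by \<open>0\<close> gives \<open>0\<close> on both sides.\<close>

lemma eval_rf_hom:
  fixes H :: "'k::field \<Rightarrow> 'l::field"
  assumes "rhom H" "rhom h"
  shows "H (eval_rf h f a b) = eval_rf (\<lambda>c. H (h c)) f (H a) (H b)"
  by (simp add: eval_rf_def eval_pol_eval2 rhom_divide eval2_hom assms)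

lemma generic_hom:
  fixes H :: "'k::field \<Rightarrow> 'l::field"
  assumes "rhom H" "rhom h" "generic h a b"
  shows "generic (\<lambda>c. H (h c)) (H a) (H b)"
  using assms(3) by (simp add: generic_def eval2_hom[OF assms(1,2), symmetric] rhom_eq_0_iff[OF assms(1)])

lemma generic_XY: "generic const_rf varX varY"
  by (simp add: generic_def to_fract_eq_eval2[symmetric])

lemma eval_rf_XY: "eval_rf const_rf f varX varY = f"
proof -
  obtain p q where pq: "f = Fract p q" "q \<noteq> 0" by (cases f)
  have "takes const_rf (to_fract p / to_fract q) varX varY (to_fract p / to_fract q)"
    using pq(2) takes_to_fract[OF rhom_const_rf, of _ varX varY, folded to_fract_eq_eval2]
    by (intro takes_intros[OF rhom_const_rf]) auto
  thus ?thesis using pq by (simp add: takes_iff[OF rhom_const_rf] to_fract_def)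
qed

section \<open>Homogeneous rational functions\<close>

text \<open>\<open>p(az, bz)\<close> as an element of \<open>K[z]\<close> instead of \<open>K(z)\<close>, so that any value can be substituted for \<open>z\<close>.\<close>

abbreviation evalz :: "real poly poly \<Rightarrow> ratfun \<Rightarrow> ratfun \<Rightarrow> ratfun poly" where
  "evalz p a b \<equiv> eval2 (\<lambda>c. [:const_rf c:]) p [:0, a:] [:0, b:]"

lemma rhom_const_rf_poly: "rhom (\<lambda>c. [:const_rf c:])"
  by (rule rhom_comp[OF rhom_const_poly rhom_const_rf])

lemma eval2_const3: "eval2 const3 p (lift3 a * varZ) (lift3 b * varZ) = to_fract (evalz p a b)"
  by (simp add: eval2_hom[OF rhom_to_fract rhom_const_rf_poly] const3_def[abs_def] lift3_def varZ_def
      flip: to_fract_mult)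

lemma poly_evalz: "poly (evalz p a b) w = eval2 const_rf p (a * w) (b * w)"
  by (simp add: eval2_hom[OF rhom_poly rhom_const_rf_poly] mult.commute)

lemma value_at_poly_point:
  "value_at (\<lambda>p. poly p w) (lift3 f) f" "value_at (\<lambda>p. poly p w) varZ w"
  "value_at (\<lambda>p. poly p w) (const3 c) (const_rf c)"
  using value_at_to_fract[OF rhom_poly, of w "[:f:]"] value_at_to_fract[OF rhom_poly, of w "[:0, 1:]"]
    value_at_to_fract[OF rhom_poly, of w "[:const_rf c:]"]
  by (simp_all add: lift3_def varZ_def const3_def)

text \<open>The point specialises to \<open>(a, b)\<close> at \<open>z = 1\<close>.\<close>

lemma generic_scaled:
  assumes "generic const_rf a b"
  shows "generic const3 (lift3 a * varZ) (lift3 b * varZ)"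
proof (rule generic_of_value_at[OF rhom_poly rhom_const3 rhom_const_rf value_at_poly_point(3)])
  show "value_at (\<lambda>p. poly p 1) (lift3 a * varZ) (a * 1)" "value_at (\<lambda>p. poly p 1) (lift3 b * varZ) (b * 1)"
    by (intro value_at_intros[OF rhom_poly] value_at_poly_point)+
qed (use assms in simp)

lemma rhom_scale_rf: "rhom scale_rf"
  unfolding scale_rf_def by (rule rhom_eval_rf[OF rhom_const3 generic_scaled[OF generic_XY]])

lemma scale_const [simp]: "scale_rf (const_rf c) = const3 c"
  unfolding scale_rf_def by (rule takes_eval[OF rhom_const3 takes_const[OF rhom_const3]])

lemma varZ_nonzero [simp]: "varZ \<noteq> 0"
  by (simp add: varZ_def)

lemma varX_nonzero [simp]: "varX \<noteq> 0"
  and varY_nonzero [simp]: "varY \<noteq> 0"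
  by (simp_all add: varX_def varY_def)

lemma homogeneous_X: "homogeneous 1 varX" and homogeneous_Y: "homogeneous 1 varY"
  unfolding homogeneous_def scale_rf_def
  by (simp_all add: takes_eval[OF rhom_const3 takes_X[OF rhom_const3]] takes_eval[OF rhom_const3 takes_Y[OF rhom_const3]])

lemma homogeneous_const: "homogeneous 0 (const_rf c)"
  by (simp add: homogeneous_def const3_def)

context begin
interpretation S: rhom scale_rf by (rule rhom_scale_rf)
interpretation L: rhom lift3 by (rule rhom_lift3)

lemma homogeneous_mult: "homogeneous d f \<Longrightarrow> homogeneous e g \<Longrightarrow> homogeneous (d + e) (f * g)"
  by (simp add: homogeneous_def S.simps L.simps power_add)

lemma homogeneous_add: "homogeneous d f \<Longrightarrow> homogeneous d g \<Longrightarrow> homogeneous d (f + g)"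
  by (simp add: homogeneous_def S.simps L.simps algebra_simps)

lemma homogeneous_diff: "homogeneous d f \<Longrightarrow> homogeneous d g \<Longrightarrow> homogeneous d (f - g)"
  by (simp add: homogeneous_def S.simps L.simps algebra_simps)

lemma homogeneous_divide: "homogeneous (d + e) f \<Longrightarrow> homogeneous e g \<Longrightarrow> homogeneous d (f / g)"
  by (cases "g = 0")
    (simp_all add: homogeneous_def rhom_divide[OF rhom_scale_rf] rhom_divide[OF rhom_lift3] power_add
      rhom_eq_0_iff[OF rhom_lift3] S.simps L.simps)

lemma scale_eval2: "scale_rf (eval2 const_rf F P Q) = eval2 const3 F (scale_rf P) (scale_rf Q)"
  by (simp add: eval2_hom[OF rhom_scale_rf rhom_const_rf])

text \<open>The main tool for using homogeneity. Scaling turns \<open>F(P, Q) = f G(P, Q)\<close> into an identity between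
polynomials in \<open>z\<close>, in which \<open>z\<close> may be replaced by an arbitrary element \<open>w\<close> of \<open>K\<close>, such as \<open>c / P\<close>.\<close>

lemma homogeneous_specialise:
  assumes "homogeneous 1 P" "homogeneous 1 Q" "homogeneous 0 f"
    and "eval2 const_rf F P Q = f * eval2 const_rf G P Q"
  shows "eval2 const_rf F (P * w) (Q * w) = f * eval2 const_rf G (P * w) (Q * w)"
proof -
  have "to_fract (evalz F P Q) = lift3 f * to_fract (evalz G P Q)"
    using arg_cong[OF assms(4), of scale_rf] assms(1-3)
    by (simp add: scale_eval2 S.simps homogeneous_def mult.commute[of varZ] eval2_const3)
  hence "evalz F P Q = [:f:] * evalz G P Q"
    by (simp add: lift3_def flip: to_fract_mult)
  from arg_cong[OF this, of "\<lambda>p. poly p w"] show ?thesis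
    by (simp add: poly_evalz)
qed

end

text \<open>A relation between \<open>PA\<close> and \<open>QA\<close> specialises, with \<open>w = 1 / A\<close>, to a relation between \<open>P\<close> and \<open>Q\<close>.\<close>

lemma generic_mult_0_homogeneous:
  assumes "homogeneous 1 P" "homogeneous 1 Q" "generic const_rf P Q" "A \<noteq> 0"
    "homogeneous 0 A"
  shows "generic const_rf (P * A) (Q * A)"
  unfolding generic_def
proof safe
  fix F assume F: "eval2 const_rf F (P * A) (Q * A) = 0"
  have "homogeneous 1 (P * A)" "homogeneous 1 (Q * A)"
    using homogeneous_mult[OF assms(1,5)] homogeneous_mult[OF assms(2,5)] by simp_all
  from homogeneous_specialise[OF this homogeneous_const[of 0], of F 0 "inverse A"] F
  have "eval2 const_rf F P Q = 0"
    using assms(4) by (simp add: mult.assoc rhom.zero[OF rhom_const_rf])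
  thus "F = 0" using assms(3) by (simp add: generic_def)
qed

section \<open>Rational functions of one element\<close>

text \<open>The field \<open>\<real>(t)\<close> inside \<open>K\<close>.\<close>

definition ratfuns_of :: "ratfun \<Rightarrow> ratfun set" where
  "ratfuns_of t = {poly (map_poly const_rf p) t / poly (map_poly const_rf q) t | p q.
     poly (map_poly const_rf q) t \<noteq> 0}"

definition transcendental :: "ratfun \<Rightarrow> bool" where
  "transcendental t \<longleftrightarrow> (\<forall>p. poly (map_poly const_rf p) t = 0 \<longrightarrow> p = 0)"

lemma eval_rf_0_homogeneous_scaled:
  assumes "homogeneous 0 f" "generic const_rf (varX * w) (varY * w)"
  shows "eval_rf const_rf f (varX * w) (varY * w) = f"
proof -
  obtain p q where pq: "f = Fract p q" "q \<noteq> 0" by (cases f)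
  have "eval2 const_rf p varX varY = f * eval2 const_rf q varX varY"
    using pq by (simp add: to_fract_def mult_rat flip: to_fract_eq_eval2)
      (simp add: eq_fract)
  from homogeneous_specialise[OF homogeneous_X homogeneous_Y assms(1) this]
  have "eval2 const_rf p (varX * w) (varY * w) = f * eval2 const_rf q (varX * w) (varY * w)" .
  moreover have "eval2 const_rf q (varX * w) (varY * w) \<noteq> 0"
    using assms(2) pq by (auto simp: generic_def)
  ultimately show ?thesis
    using eval_rf_Fract(2)[of const_rf q "varX * w" "varY * w" p] pq
    by (simp add: eval_pol_eval2 rhom.simps[OF rhom_const_rf])
qed

text \<open>A relation for \<open>y / x\<close> can be evaluated at the real points \<open>(1, b)\<close>.\<close>

lemma transcendental_YX: "transcendental (varY / varX)"
  unfolding transcendental_def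
proof safe
  fix p assume p: "poly (map_poly const_rf p) (varY / varX) = 0"
  have "poly p x = poly 0 x" for x
  proof -
    have "takes (\<lambda>c. c) (varY / varX) 1 x (x / 1)"
      by (intro takes_intros rhom_id) simp
    from takes_poly[OF rhom_id this, of p] have "takes (\<lambda>c. c) 0 1 x (poly p x)"
      by (simp add: p)
    from takes_unique[OF rhom_id this takes_0[OF rhom_id]] show ?thesis by simp
  qed
  thus "p = 0" by (simp add: fun_eq_iff flip: poly_eq_poly_eq_iff)
qed

lemma subst_eval_poly:
  assumes "generic const_rf P Q"
  shows "eval_rf const_rf (poly (map_poly const_rf p) t) P Q
    = poly (map_poly const_rf p) (eval_rf const_rf t P Q)"
  by (rule takes_eval[OF rhom_const_rf takes_poly[OF rhom_const_rf generic_takes[OF rhom_const_rf assms]]])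

lemma subst_X [simp]: "eval_rf const_rf varX P Q = P"
  and subst_Y [simp]: "eval_rf const_rf varY P Q = Q"
  and subst_const [simp]: "eval_rf const_rf (const_rf c) P Q = const_rf c"
  using takes_X[OF rhom_const_rf] takes_Y[OF rhom_const_rf] takes_const[OF rhom_const_rf]
  by (auto intro: takes_eval[OF rhom_const_rf])

lemma generic_transcendental:
  assumes "generic const_rf P Q"
  shows "transcendental (Q / P)"
  unfolding transcendental_def
proof safe
  fix p assume p: "poly (map_poly const_rf p) (Q / P) = 0"
  note S = rhom_eval_rf[OF rhom_const_rf assms]
  have "eval_rf const_rf (poly (map_poly const_rf p) (varY / varX)) P Q = 0"
    by (simp add: subst_eval_poly[OF assms] rhom_divide[OF S] p)
  hence "poly (map_poly const_rf p) (varY / varX) = 0" by (simp add: rhom_eq_0_iff[OF S])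
  thus "p = 0" using transcendental_YX by (simp add: transcendental_def)
qed

lemma eval_rf_generic:
  assumes "rhom h" "generic h a b"
  obtains p q where "eval_rf h f a b = eval2 h p a b / eval2 h q a b" "q \<noteq> 0"
  using that snd_quot_of_fract_nonzero[of f] by (simp add: eval_rf_def eval_pol_eval2)

text \<open>Any nonzero real \<open>c\<close> that is not a root of the leading coefficient of \<open>q\<close> in \<open>y\<close> will do.\<close>

lemma exists_nonvanishing_section:
  fixes q :: "real poly poly"
  assumes "q \<noteq> 0"
  obtains c where "c \<noteq> 0" "map_poly (\<lambda>a. poly a c) q \<noteq> 0"
proof -
  have "finite {x. poly (lead_coeff q * [:0, 1:]) x = 0}"
    using assms by (intro poly_roots_finite) (simp add: mult_eq_0_iff)
  then obtain c where c: "poly (lead_coeff q * [:0, 1:]) c \<noteq> 0"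
    using ex_new_if_finite[OF infinite_UNIV_char_0] by (metis (mono_tags, lifting) mem_Collect_eq)
  have "coeff (map_poly (\<lambda>a. poly a c) q) (degree q) \<noteq> 0"
    using c by (simp add: coeff_map_poly)
  with c that[of c] show ?thesis by force
qed

lemma eval2_const_left:
  "eval2 const_rf p (const_rf c) t = poly (map_poly const_rf (map_poly (\<lambda>a. poly a c) p)) t"
proof -
  interpret C: rhom const_rf by (rule rhom_const_rf)
  show ?thesis
    unfolding eval2_def
    by (intro arg_cong2[where f = poly] refl poly_eqI)
      (simp add: coeff_map_poly C.poly C.zero)
qed

lemma poly_map_pcompose_linear:
  "poly (map_poly const_rf (pcompose r [:0, c:])) t = poly (map_poly const_rf r) (const_rf c * t)"
proof -
  interpret C: rhom const_rf by (rule rhom_const_rf)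
  interpret M: rhom "map_poly const_rf" by (rule rhom_map_poly[OF rhom_const_rf])
  show ?thesis
    by (induction r) (simp_all add: pcompose_pCons M.simps map_poly_pCons map_poly_smult C.simps algebra_simps)
qed

text \<open>A 0-homogeneous function \<open>f = h(P, Q)\<close> depends on \<open>Q / P\<close> only, since \<open>f = h(wP, wQ)\<close> for every \<open>w\<close> where
this makes sense. Taking \<open>w = 1 / P\<close> would give \<open>f = h(1, Q / P)\<close>, but the denominator of \<open>h\<close> may vanish on
the line \<open>x = 1\<close>; therefore \<open>w = c / P\<close> for a suitable real \<open>c\<close>. With \<open>(P, Q) = (x, y)\<close> this is the
usual description of the 0-homogeneous functions.\<close>

lemma homogeneous_0_rational_in_quotient:
  assumes PQ: "homogeneous 1 P" "homogeneous 1 Q" "generic const_rf P Q"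
    and f: "homogeneous 0 f" "f = eval_rf const_rf h P Q"
  shows "f \<in> ratfuns_of (Q / P)"
proof -
  obtain p q where pq: "f = eval2 const_rf p P Q / eval2 const_rf q P Q" "q \<noteq> 0"
    using eval_rf_generic[OF rhom_const_rf PQ(3)] f(2) by metis
  hence *: "eval2 const_rf p P Q = f * eval2 const_rf q P Q"
    using PQ(3) by (auto simp: generic_def)
  obtain c where c: "c \<noteq> 0" "map_poly (\<lambda>a. poly a c) q \<noteq> 0"
    using exists_nonvanishing_section[OF pq(2)] .
  \<comment> \<open>\<open>u p\<close> is the polynomial \<open>p(c, cv)\<close> in \<open>v\<close>.\<close>
  define u where "u = (\<lambda>p. pcompose (map_poly (\<lambda>a. poly a c) p) [:0, c:])"
  have u: "eval2 const_rf p (const_rf c) (const_rf c * (Q / P)) = poly (map_poly const_rf (u p)) (Q / P)"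
    for p by (simp add: eval2_const_left u_def poly_map_pcompose_linear)
  have "P \<noteq> 0"
    using PQ(3) eval2_simps(2)[OF rhom_const_rf, of P Q] by (auto simp: generic_def)
  hence "P * (const_rf c / P) = const_rf c" "Q * (const_rf c / P) = const_rf c * (Q / P)"
    by simp_all
  hence "poly (map_poly const_rf (u p)) (Q / P) = f * poly (map_poly const_rf (u q)) (Q / P)"
    using homogeneous_specialise[OF PQ(1,2) f(1) *, of "const_rf c / P"] by (simp only: u)
  moreover have "u q \<noteq> 0"
    using c pcompose_eq_0[of "map_poly (\<lambda>a. poly a c) q" "[:0, c:]"] by (auto simp: u_def)
  hence "poly (map_poly const_rf (u q)) (Q / P) \<noteq> 0"
    using generic_transcendental[OF PQ(3)] by (auto simp: transcendental_def)
  ultimately have "f = poly (map_poly const_rf (u p)) (Q / P) / poly (map_poly const_rf (u q)) (Q / P)"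
    by (simp add: field_simps)
  thus ?thesis
    unfolding ratfuns_of_def using \<open>poly (map_poly const_rf (u q)) (Q / P) \<noteq> 0\<close> by blast
qed

lemma homogeneous_ratfuns_of:
  assumes "homogeneous 0 t" "f \<in> ratfuns_of t"
  shows "homogeneous 0 f"
proof -
  have "scale_rf (poly (map_poly const_rf p) t) = lift3 (poly (map_poly const_rf p) t)" for p
    using assms(1) by (simp add: rhom.poly[OF rhom_scale_rf] rhom.poly[OF rhom_lift3] homogeneous_def
      map_poly_map_poly rhom.zero[OF rhom_const_rf] rhom.zero[OF rhom_scale_rf] rhom.zero[OF rhom_lift3] o_def const3_def)
  thus ?thesis using assms(2)
    by (auto simp: ratfuns_of_def homogeneous_def rhom_divide[OF rhom_scale_rf] rhom_divide[OF rhom_lift3])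
qed

text \<open>Writing \<open>f = p(t) / q(t)\<close> with \<open>t = Q / P\<close>, invariance says \<open>p(t / (Q + 1)) q(t) = p(t) q(t / (Q + 1))\<close>. As \<open>P\<close> and
\<open>Q\<close> are independent, \<open>t\<close> and \<open>t / (Q + 1)\<close> can be specialised to any two distinct nonzero reals \<open>w\<close> and \<open>v\<close>. With \<open>w\<close> fixed, \<open>p\<close> is
proportional to \<open>q\<close>.\<close>

lemma invariant_constant:
  assumes PQ: "generic const_rf P Q" and f: "f \<in> ratfuns_of (Q / P)"
    and h: "rhom h" "\<And>c. h (const_rf c) = const_rf c" "h P = P" "h Q = Q / (Q + 1)" "h f = f"
  shows "\<exists>c. f = const_rf c"
proof -
  interpret h: rhom h by fact
  interpret C: rhom const_rf by (rule rhom_const_rf)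
  define e where "e = (\<lambda>p t. poly (map_poly const_rf p) t)"
  obtain p q where pq: "f = e p (Q / P) / e q (Q / P)" "e q (Q / P) \<noteq> 0"
    using f by (auto simp: ratfuns_of_def e_def)
  have he: "h (e p t) = e p (h t)" for p t
    by (simp add: e_def h.poly map_poly_map_poly C.zero o_def h(2) h.zero)
  have "e p (h (Q / P)) / e q (h (Q / P)) = e p (Q / P) / e q (Q / P)"
    using h(5) pq(1) by (simp add: rhom_divide[OF h(1)] he)
  moreover have "e q (h (Q / P)) \<noteq> 0"
    using pq(2) rhom_eq_0_iff[OF h(1)] by (simp flip: he)
  ultimately have eq: "e p (Q / (Q + 1) / P) * e q (Q / P) = e p (Q / P) * e q (Q / (Q + 1) / P)"
    using pq(2) by (simp add: field_simps rhom_divide[OF h(1)] h)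
  note S = rhom_eval_rf[OF rhom_const_rf PQ]
  let ?t = "varY / varX" and ?u = "varY / (varY + 1) / varX"
  have "e p ?u * e q ?t = e p ?t * e q ?u"
    by (rule iffD1[OF rhom_eq_iff[OF S]])
      (use eq in \<open>simp add: rhom.simps[OF S] rhom_divide[OF S] e_def subst_eval_poly[OF PQ]\<close>)
  have real_eq: "poly p v * poly q w = poly p w * poly q v" if "v \<noteq> 0" "w \<noteq> 0" "v \<noteq> w" for v w
  proof -
    \<comment> \<open>The real point \<open>(a, b)\<close> is the one with \<open>b / a = w\<close> and \<open>b / ((b + 1) a) = v\<close>.\<close>
    define b where "b = w / v - 1"
    define a where "a = b / w"
    have nz: "a \<noteq> 0" "b + 1 \<noteq> 0" "b \<noteq> 0" using that by (auto simp: a_def b_def field_simps)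
    have "b / a = w" using nz that by (simp add: a_def)
    hence w: "takes (\<lambda>c. c) ?t a b w" using takes_intros[OF rhom_id] nz by metis
    have "b / (b + 1) / a = v" using nz that by (simp add: a_def b_def)
    moreover have "takes (\<lambda>c. c) ?u a b (b / (b + 1) / a)" using nz by (intro takes_intros rhom_id) auto
    ultimately have v: "takes (\<lambda>c. c) ?u a b v" by simp
    have ee: "takes (\<lambda>c. c) (e r t) a b (poly r z)" if "takes (\<lambda>c. c) t a b z" for r t z
      using takes_poly[OF rhom_id that, of r] by (simp add: e_def)
    from takes_mult[OF rhom_id ee[OF v] ee[OF w], of p q] takes_mult[OF rhom_id ee[OF w] ee[OF v], of p q]
    show ?thesis using \<open>e p ?u * e q ?t = e p ?t * e q ?u\<close> by (simp add: takes_iff[OF rhom_id])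
  qed
  have "q \<noteq> 0" using pq(2) by (auto simp: e_def)
  hence "finite {x. poly (q * [:0, 1:]) x = 0}"
    by (intro poly_roots_finite) (simp add: mult_eq_0_iff)
  then obtain w where w: "poly (q * [:0, 1:]) w \<noteq> 0"
    using ex_new_if_finite[OF infinite_UNIV_char_0] by (metis (mono_tags, lifting) mem_Collect_eq)
  have "smult (poly q w) p - smult (poly p w) q = 0"
  proof (rule ccontr)
    assume "smult (poly q w) p - smult (poly p w) q \<noteq> 0"
    from poly_roots_finite[OF this]
    have "finite ({v. poly (smult (poly q w) p - smult (poly p w) q) v = 0} \<union> {0, w})" by simp
    moreover have "{v. poly (smult (poly q w) p - smult (poly p w) q) v = 0} \<union> {0, w} = UNIV"
      using real_eq w by (auto simp: algebra_simps)
    ultimately show False using infinite_UNIV_char_0[where 'a = real] by metis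
  qed
  hence "smult (poly q w) p = smult (poly p w) q" by simp
  moreover have "e (smult a r) t = const_rf a * e r t" for a r t
    by (simp add: e_def map_poly_smult C.zero C.mult)
  ultimately have "const_rf (poly q w) * e p (Q / P) = const_rf (poly p w) * e q (Q / P)" by metis
  moreover have "const_rf (poly q w) \<noteq> 0" using w by (simp add: rhom_eq_0_iff[OF rhom_const_rf])
  ultimately have "f = const_rf (poly p w / poly q w)"
    using pq by (simp add: rhom_divide[OF rhom_const_rf] frac_eq_eq mult.commute)
  thus ?thesis ..
qed

lemma ratfuns_of_coprime:
  assumes "f \<in> ratfuns_of t"
  obtains p q where "coprime p q" "f = poly (map_poly const_rf p) t / poly (map_poly const_rf q) t"
    "poly (map_poly const_rf q) t \<noteq> 0"
proof -
  interpret M: rhom "\<lambda>p. poly (map_poly const_rf p) t" by (rule rhom_eval1[OF rhom_const_rf])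
  obtain p q where pq: "f = poly (map_poly const_rf p) t / poly (map_poly const_rf q) t"
    "poly (map_poly const_rf q) t \<noteq> 0"
    using assms by (auto simp: ratfuns_of_def)
  have "gcd p q \<noteq> 0" using pq(2) by auto
  then obtain p' q' where *: "p = p' * gcd p q" "q = q' * gcd p q" "coprime p' q'"
    using gcd_coprime_exists by blast
  have "poly (map_poly const_rf q) t = poly (map_poly const_rf q') t * poly (map_poly const_rf (gcd p q)) t"
    "poly (map_poly const_rf p) t = poly (map_poly const_rf p') t * poly (map_poly const_rf (gcd p q)) t"
    using *(1,2) M.mult by metis+
  thus ?thesis using that[OF *(3)] pq by auto
qed

text \<open>The degree-one case of the computation \<open>[\<real>(s) : \<real>(g(s))] = deg g\<close>. Let \<open>t = p(s) / q(s)\<close> and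
\<open>s = a(t) / b(t)\<close> in lowest terms. Clearing denominators gives a polynomial identity
\<open>H a = X * H b\<close>, where \<open>H r\<close> is \<open>r\<close> homogenised in degree \<open>n\<close> and evaluated at \<open>(p, q)\<close>. Modulo \<open>q\<close> only the
top coefficients survive, modulo \<open>p\<close> only the constant ones, so \<open>q\<close> and \<open>p\<close> divide nonzero polynomials of
degree at most \<open>1\<close>.\<close>

lemma moebius_if_mutually_rational:
  assumes "transcendental s" "t \<in> ratfuns_of s" "s \<in> ratfuns_of t"
  shows "\<exists>\<alpha> \<beta> \<gamma> \<delta>. const_rf \<gamma> * s + const_rf \<delta> \<noteq> 0 \<and>
    t = (const_rf \<alpha> * s + const_rf \<beta>) / (const_rf \<gamma> * s + const_rf \<delta>)"
proof -
  interpret C: rhom const_rf by (rule rhom_const_rf)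
  let ?e = "\<lambda>p t. poly (map_poly const_rf p) t"
  obtain p q where pq: "coprime p q" "t = ?e p s / ?e q s" "?e q s \<noteq> 0"
    using ratfuns_of_coprime[OF assms(2)] .
  obtain a b where ab: "coprime a b" "s = ?e a t / ?e b t" "?e b t \<noteq> 0"
    using ratfuns_of_coprime[OF assms(3)] .
  interpret M: rhom "\<lambda>p. ?e p s" by (rule rhom_eval1[OF rhom_const_rf])
  define n where "n = max (degree a) (degree b)"
  define H where "H = (\<lambda>r. \<Sum>i\<le>n. smult (coeff r i) (p ^ i * q ^ (n - i)))"
  have Ms: "?e (sum g A) s = (\<Sum>i\<in>A. ?e (g i) s)" if "finite A" for g and A :: "nat set"
    using that by (induction A rule: finite_induct) (simp_all add: M.add M.zero)
  have H: "?e (H r) s = ?e r t * ?e q s ^ n" if "degree r \<le> n" for r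
  proof -
    have "?e (H r) s = (\<Sum>i\<le>n. const_rf (coeff r i) * (?e p s ^ i * ?e q s ^ (n - i)))"
      by (simp add: H_def Ms map_poly_smult C.zero C.mult M.mult M.power)
    also have "\<dots> = (\<Sum>i\<le>n. const_rf (coeff r i) * t ^ i) * ?e q s ^ n"
      unfolding sum_distrib_right using pq(3)
      by (intro sum.cong refl) (auto simp: pq(2) power_divide field_simps simp flip: power_add)
    also have "(\<Sum>i\<le>n. const_rf (coeff r i) * t ^ i) = ?e r t"
      unfolding poly_altdef using that
      by (intro sum.mono_neutral_cong_right)
        (auto simp: coeff_map_poly C.zero degree_map_poly rhom_eq_0_iff[OF rhom_const_rf] coeff_eq_0)
    finally show ?thesis .
  qed
  have "?e a t = s * ?e b t" using ab(2,3) by (metis nonzero_eq_divide_eq)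
  moreover have "?e (H a) s = ?e a t * ?e q s ^ n" "?e (H b) s = ?e b t * ?e q s ^ n"
    by (simp_all add: H n_def)
  ultimately have "?e (H a) s = s * ?e (H b) s" by (simp only: mult.assoc)
  hence "?e (H a - [:0, 1:] * H b) s = 0"
    by (simp add: M.diff M.mult map_poly_pCons C.zero C.one del: mult_pCons_left)
  hence Hab: "H a = [:0, 1:] * H b" using assms(1) unfolding transcendental_def by fastforce
  have top: "q dvd H r - smult (coeff r n) (p ^ n)" for r
  proof -
    have "H r - smult (coeff r n) (p ^ n) = (\<Sum>i<n. smult (coeff r i) (p ^ i * q ^ (n - i)))"
      by (simp add: H_def lessThan_Suc_atMost[symmetric])
    also have "q dvd \<dots>"
      by (intro dvd_sum dvd_smult dvd_mult) (simp add: dvd_power)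
    finally show ?thesis .
  qed
  have bot: "p dvd H r - smult (coeff r 0) (q ^ n)" for r
  proof -
    have "H r - smult (coeff r 0) (q ^ n) = (\<Sum>i\<in>{1..n}. smult (coeff r i) (p ^ i * q ^ (n - i)))"
      by (simp add: H_def sum.atLeast1_atMost_eq sum.atMost_shift)
    also have "p dvd \<dots>"
      by (intro dvd_sum dvd_smult dvd_mult2) (simp add: dvd_power)
    finally show ?thesis .
  qed
  have deg: "degree u \<le> 1"
    if u: "coprime u v" and d: "\<And>r. u dvd H r - smult (c r) (v ^ n)" and nz: "c a \<noteq> 0 \<or> c b \<noteq> 0"
    for u v :: "real poly" and c
  proof -
    have "u dvd (H a - smult (c a) (v ^ n)) - [:0, 1:] * (H b - smult (c b) (v ^ n))"
      by (intro dvd_diff dvd_mult d)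
    also have "\<dots> = - ([:c a, - c b:] * v ^ n)"
      by (simp add: Hab algebra_simps)
    finally have "u dvd [:c a, - c b:] * v ^ n"
      by (simp only: dvd_minus_iff)
    moreover have "coprime u (v ^ n)" using u by simp
    ultimately have "u dvd [:c a, - c b:]"
      by (simp only: coprime_dvd_mult_left_iff)
    hence "degree u \<le> degree [:c a, - c b:]" using nz by (intro dvd_imp_degree_le) auto
    thus ?thesis by (simp split: if_splits)
  qed
  have "b \<noteq> 0" using ab(3) by auto
  hence "coeff a n \<noteq> 0 \<or> coeff b n \<noteq> 0"
    using leading_coeff_0_iff[of a] leading_coeff_0_iff[of b] by (auto simp: n_def max_def)
  hence q: "degree q \<le> 1" using deg[of q p "\<lambda>r. coeff r n"] top pq(1) by (simp add: coprime_commute)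
  have "coeff a 0 \<noteq> 0 \<or> coeff b 0 \<noteq> 0"
  proof (rule ccontr)
    assume "\<not> ?thesis"
    hence "[:0, 1:] dvd a" "[:0, 1:] dvd b"
      by (simp_all add: dvd_iff_poly_eq_0[of 0, simplified] poly_0_coeff_0)
    with ab(1) have "is_unit [:0, 1 :: real:]" using coprime_common_divisor by blast
    thus False by (simp add: is_unit_iff_degree)
  qed
  hence p: "degree p \<le> 1" using deg[of p q "\<lambda>r. coeff r 0"] bot pq(1) by simp
  have lin: "?e r s = const_rf (coeff r 1) * s + const_rf (coeff r 0)" if "degree r \<le> 1" for r
  proof -
    have "r = [:coeff r 0, coeff r 1:]"
      using that by (intro poly_eqI) (auto simp: coeff_pCons coeff_eq_0 split: nat.splits)
    hence "?e r s = ?e [:coeff r 0, coeff r 1:] s" by simp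
    thus ?thesis by (simp add: map_poly_pCons C.zero algebra_simps)
  qed
  show ?thesis using pq(2,3) lin[OF p] lin[OF q] by metis
qed

section \<open>Rational maps\<close>

abbreviation subst :: "ratfun \<Rightarrow> ratfun \<Rightarrow> ratfun \<Rightarrow> ratfun" where
  "subst f a b \<equiv> eval_rf const_rf f a b"

lemma comp_rm_pair: "(f, g) \<circ>\<^sub>r (a, b) = (subst f a b, subst g a b)"
  by (simp add: comp_rm_def subst_rf_def)

lemma comp_rm_takes:
  "takes const_rf f a b u \<Longrightarrow> takes const_rf g a b v \<Longrightarrow> (f, g) \<circ>\<^sub>r (a, b) = (u, v)"
  "takes const_rf f a b u \<Longrightarrow> takes const_rf g a b v \<Longrightarrow> composable (f, g) (a, b)"
  by (simp_all add: comp_rm_pair composable_def takes_iff[OF rhom_const_rf])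

lemma subst_subst:
  assumes "generic const_rf c d"
  shows "subst (subst f a b) c d = subst f (subst a c d) (subst b c d)"
  by (subst eval_rf_hom[OF rhom_eval_rf[OF rhom_const_rf assms] rhom_const_rf]) simp

lemma generic_subst:
  assumes "generic const_rf a b" "generic const_rf c d"
  shows "generic const_rf (subst a c d) (subst b c d)"
  using generic_hom[OF rhom_eval_rf[OF rhom_const_rf assms(2)] rhom_const_rf assms(1)] by simp

lemma inverse_rm_pair:
  "inverse_rm (a, b) (c, d) \<longleftrightarrow> takes const_rf a c d varX \<and> takes const_rf b c d varY
    \<and> takes const_rf c a b varX \<and> takes const_rf d a b varY"
  by (auto simp: inverse_rm_def comp_rm_pair composable_def id_rm_def takes_iff[OF rhom_const_rf])

lemma inverse_rm_sym: "inverse_rm l m \<Longrightarrow> inverse_rm m l"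
  by (simp add: inverse_rm_def)

text \<open>Substituting the inverse map \<open>(c, d)\<close> specialises \<open>(a, b)\<close> to the generic point \<open>(x, y)\<close>.\<close>

lemma inverse_rm_generic:
  assumes "inverse_rm (a, b) (c, d)"
  shows "generic const_rf a b"
proof (rule generic_of_value_at[OF rhom_eval2 rhom_const_rf rhom_const_rf _ _ _ generic_XY])
  show "value_at (\<lambda>p. eval2 const_rf p c d) a varX" "value_at (\<lambda>p. eval2 const_rf p c d) b varY"
    using assms by (simp_all add: inverse_rm_pair takes_def)
qed (use takes_const[OF rhom_const_rf] in \<open>auto simp: takes_def intro: rhom_const_rf\<close>)

lemma conjugate_rmE:
  assumes "conjugate_rm (P, Q) phi_one (u, v)"
  obtains c d where "inverse_rm (P, Q) (c, d)" "generic const_rf P (Q / (Q + 1))"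
    "u = subst c P (Q / (Q + 1))" "v = subst d P (Q / (Q + 1))"
proof -
  note CI = takes_intros[OF rhom_const_rf]
  obtain c d where m: "inverse_rm (P, Q) (c, d)" and uv: "(u, v) = (c, d) \<circ>\<^sub>r phi_one \<circ>\<^sub>r (P, Q)"
    using assms by (force simp: conjugate_rm_def)
  have PQ: "generic const_rf P Q" using inverse_rm_generic[OF m] .
  have nz: "varY + 1 \<noteq> 0" "1 - varY \<noteq> 0"
    by (simp_all add: varY_def one_pCons flip: to_fract_1 to_fract_add to_fract_diff)
  hence n1: "varY / (1 - varY) + 1 \<noteq> 0" "1 - varY / (varY + 1) \<noteq> 0" by (simp_all add: field_simps)
  have "takes const_rf (varY / (varY + 1)) varX (varY / (1 - varY)) (varY / (1 - varY) / (varY / (1 - varY) + 1))"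
    "takes const_rf (varY / (1 - varY)) varX (varY / (varY + 1)) (varY / (varY + 1) / (1 - varY / (varY + 1)))"
    using n1 by (intro CI; simp)+
  moreover have "varY / (1 - varY) / (varY / (1 - varY) + 1) = varY"
    "varY / (varY + 1) / (1 - varY / (varY + 1)) = varY"
    using nz by (simp_all add: field_simps)
  ultimately have "inverse_rm (varX, varY / (varY + 1)) (varX, varY / (1 - varY))"
    by (simp add: inverse_rm_pair CI)
  from generic_subst[OF inverse_rm_generic[OF this] PQ]
  have G: "generic const_rf P (Q / (Q + 1))" and pQ: "subst (varY / (varY + 1)) P Q = Q / (Q + 1)"
    by (simp_all add: rhom_divide[OF rhom_eval_rf[OF rhom_const_rf PQ]] rhom.simps[OF rhom_eval_rf[OF rhom_const_rf PQ]])
  have "u = subst c P (Q / (Q + 1))" "v = subst d P (Q / (Q + 1))"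
    using uv by (simp_all add: phi_one_def comp_rm_pair pQ)
  thus thesis using that m G by blast
qed

text \<open>A conjugacy to \<open>(x, y / (y + 1))\<close> in terms of functions: \<open>P\<close> is invariant, \<open>1 / Q\<close> grows by \<open>1\<close>, and
\<open>P\<close> and \<open>Q\<close> generate \<open>K\<close>.\<close>

lemma conjugate_rmD:
  assumes "conjugate_rm (P, Q) phi_one (u, v)"
  shows "generic const_rf P Q" "generic const_rf u v" "subst P u v = P" "subst Q u v = Q / (Q + 1)"
    "\<exists>h. f = subst h P Q"
proof -
  obtain c d where m: "inverse_rm (P, Q) (c, d)" and G: "generic const_rf P (Q / (Q + 1))"
    and uv: "u = subst c P (Q / (Q + 1))" "v = subst d P (Q / (Q + 1))"
    using conjugate_rmE[OF assms] .
  show PQ: "generic const_rf P Q" using inverse_rm_generic[OF m] .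
  show "generic const_rf u v"
    unfolding uv by (rule generic_subst[OF inverse_rm_generic[OF inverse_rm_sym[OF m]] G])
  show "subst P u v = P" "subst Q u v = Q / (Q + 1)"
    using m unfolding uv by (simp_all add: inverse_rm_pair takes_iff[OF rhom_const_rf] flip: subst_subst[OF G])
  have "f = subst (subst f c d) P Q"
    using m by (simp add: subst_subst[OF PQ] inverse_rm_pair takes_iff[OF rhom_const_rf] eval_rf_XY)
  thus "\<exists>h. f = subst h P Q" ..
qed

text \<open>The equation \<open>(f, g) \<circ> l = l \<circ> \<psi>\<close> determines \<open>\<psi>\<close>, and the required compositions are defined because
both sides are generic points.\<close>

lemma conjugate_rmI:
  assumes m: "inverse_rm (P, Q) (c, d)" and uv: "generic const_rf u v"
    and eq: "subst f P Q = subst P u v" "subst g P Q = subst Q u v"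
  shows "conjugate_rm (P, Q) (f, g) (u, v)"
proof -
  have PQ: "generic const_rf P Q" using inverse_rm_generic[OF m] .
  hence "composable (f, g) (P, Q)"
    using generic_takes[OF rhom_const_rf] by (auto simp: composable_def takes_iff[OF rhom_const_rf])
  moreover have G: "generic const_rf (subst P u v) (subst Q u v)" by (rule generic_subst[OF PQ uv])
  hence "composable (c, d) ((f, g) \<circ>\<^sub>r (P, Q))"
    using generic_takes[OF rhom_const_rf] by (auto simp: composable_def takes_iff[OF rhom_const_rf] comp_rm_pair eq)
  moreover have "(u, v) = (c, d) \<circ>\<^sub>r (f, g) \<circ>\<^sub>r (P, Q)"
    using m by (simp add: comp_rm_pair eq inverse_rm_pair takes_iff[OF rhom_const_rf] flip: subst_subst[OF uv])
  ultimately show ?thesis using m by (auto simp: conjugate_rm_def)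
qed

text \<open>The inverse of scaling by \<open>A\<close> is scaling by \<open>1 / A\<close>, as \<open>A\<close> does not change when its arguments are scaled.\<close>

lemma inverse_rm_scaling:
  assumes A: "A \<noteq> 0" "homogeneous 0 A"
  shows "inverse_rm (varX * A, varY * A) (varX * inverse A, varY * inverse A)"
proof -
  have *: "takes const_rf (varX * inverse B) (varX * B) (varY * B) varX \<and>
    takes const_rf (varY * inverse B) (varX * B) (varY * B) varY"
    if B: "B \<noteq> 0" "homogeneous 0 B" for B
  proof -
    have g: "generic const_rf (varX * B) (varY * B)"
      by (rule generic_mult_0_homogeneous[OF homogeneous_X homogeneous_Y generic_XY B])
    have "takes const_rf B (varX * B) (varY * B) B"
      using generic_takes[OF rhom_const_rf g, of B] eval_rf_0_homogeneous_scaled[OF B(2) g] by simp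
    from takes_inverse[OF rhom_const_rf this B(1)] takes_mult[OF rhom_const_rf]
      takes_X[OF rhom_const_rf] takes_Y[OF rhom_const_rf]
    have "takes const_rf (varX * inverse B) (varX * B) (varY * B) (varX * B * inverse B)"
      "takes const_rf (varY * inverse B) (varX * B) (varY * B) (varY * B * inverse B)" by blast+
    thus ?thesis using B(1) by (simp add: mult.assoc)
  qed
  have "homogeneous 0 (inverse A)"
    using homogeneous_divide[of 0 0 1 A] homogeneous_const[of 1] A
    by (simp add: divide_inverse rhom.one[OF rhom_const_rf])
  with *[OF A] *[of "inverse A"] A(1) show ?thesis by (simp add: inverse_rm_pair)
qed

text \<open>A concrete rational function is shown to be nonzero by its value at one real point.\<close>

lemma nonzero_at_point:
  assumes "takes (\<lambda>c. c) f a b v" "v \<noteq> 0"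
  shows "f \<noteq> 0"
  using assms takes_0[OF rhom_id, of a b] takes_unique[OF rhom_id] by fastforce

lemma XY_nonzero: "varX + varY \<noteq> 0" "varX - varY \<noteq> 0"
proof -
  have "takes (\<lambda>c. c) (varX + varY) 1 0 (1 + 0)" "takes (\<lambda>c. c) (varX - varY) 1 0 (1 - 0)"
    by (intro takes_intros rhom_id)+
  thus "varX + varY \<noteq> 0" "varX - varY \<noteq> 0" using nonzero_at_point by force+
qed

lemma X_neq_Y: "varX \<noteq> varY"
  using XY_nonzero(2) by simp

section \<open>Classification of the symmetric flows of level 1\<close>

definition sigma :: "ratfun \<Rightarrow> ratfun" where "sigma f = subst f varY varX"

lemma generic_YX: "generic const_rf varY varX"
  using inverse_rm_generic[of varY varX varY varX]
  by (simp add: inverse_rm_pair takes_X takes_Y rhom_const_rf)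

lemma rhom_sigma: "rhom sigma"
  unfolding sigma_def by (rule rhom_eval_rf[OF rhom_const_rf generic_YX])

lemma sigma_simps [simp]: "sigma varX = varY" "sigma varY = varX" "sigma (const_rf c) = const_rf c"
  by (simp_all add: sigma_def)

lemma sigma_sigma [simp]: "sigma (sigma f) = f"
  by (simp add: sigma_def subst_subst[OF generic_YX] eval_rf_XY)

lemma rhom_ratfuns_of:
  assumes "rhom h" "\<And>c. h (const_rf c) = const_rf c" "f \<in> ratfuns_of t"
  shows "h f \<in> ratfuns_of (h t)"
proof -
  have e: "h (poly (map_poly const_rf p) t) = poly (map_poly const_rf p) (h t)" for p
    by (simp add: rhom.poly[OF assms(1)] map_poly_map_poly rhom.zero[OF rhom_const_rf] o_def assms(2)
      rhom.zero[OF assms(1)])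
  obtain p q where pq: "f = poly (map_poly const_rf p) t / poly (map_poly const_rf q) t"
    "poly (map_poly const_rf q) t \<noteq> 0"
    using assms(3) by (auto simp: ratfuns_of_def)
  have "h f = poly (map_poly const_rf p) (h t) / poly (map_poly const_rf q) (h t)"
    "poly (map_poly const_rf q) (h t) \<noteq> 0"
    using pq(2) by (auto simp: pq(1) rhom_divide[OF assms(1)] e rhom_eq_0_iff[OF assms(1)] simp flip: e)
  thus ?thesis by (auto simp: ratfuns_of_def)
qed

text \<open>The exchange acts on \<open>K\<close> and not on \<open>K(z)\<close>, so it cannot be applied to the homogeneity identity. But \<open>f / x\<close> is rational in \<open>y / x\<close>, so exchanging gives a function
rational in \<open>x / y\<close>.\<close>

lemma homogeneous_sigma:
  assumes "homogeneous 1 f"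
  shows "homogeneous 1 (sigma f)"
proof -
  have "homogeneous 0 (f / varX)"
    using homogeneous_divide[of 0 1 f varX] assms homogeneous_X by simp
  hence "f / varX \<in> ratfuns_of (varY / varX)"
    by (rule homogeneous_0_rational_in_quotient[OF homogeneous_X homogeneous_Y generic_XY])
      (simp add: eval_rf_XY)
  from rhom_ratfuns_of[OF rhom_sigma _ this] have "sigma (f / varX) \<in> ratfuns_of (varX / varY)"
    by (simp add: rhom_divide[OF rhom_sigma])
  moreover have "homogeneous 0 (varX / varY)"
    using homogeneous_divide[of 0 1 varX varY] homogeneous_X homogeneous_Y by simp
  ultimately have "homogeneous 0 (sigma (f / varX))" using homogeneous_ratfuns_of by blast
  from homogeneous_mult[OF homogeneous_Y this] show ?thesis
    by (simp add: rhom_divide[OF rhom_sigma])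
qed

text \<open>The 0-homogeneous coordinate in which exchanging \<open>x\<close> and \<open>y\<close> is \<open>s \<mapsto> - s\<close>.\<close>

definition ratio :: ratfun where "ratio = (varX - varY) / (varX + varY)"

lemma generic_sum_diff: "generic const_rf (varX + varY) (varX - varY)"
proof -
  note CI = takes_intros[OF rhom_const_rf]
  let ?s = "(varX + varY) / 2" and ?d = "(varX - varY) / 2"
  have "takes const_rf (varX + varY) ?s ?d (?s + ?d)" "takes const_rf (varX - varY) ?s ?d (?s - ?d)"
    "takes const_rf ?s (varX + varY) (varX - varY) ((varX + varY + (varX - varY)) / 2)"
    "takes const_rf ?d (varX + varY) (varX - varY) ((varX + varY - (varX - varY)) / 2)"
    by (intro CI; simp)+
  hence "inverse_rm (varX + varY, varX - varY) (?s, ?d)"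
    by (simp add: inverse_rm_pair field_simps)
  thus ?thesis by (rule inverse_rm_generic)
qed

lemma homogeneous_0_ratfuns_of_ratio:
  assumes "homogeneous 0 f"
  shows "f \<in> ratfuns_of ratio"
proof -
  let ?f = "subst f ((varX + varY) / 2) ((varX - varY) / 2)"
  note S = rhom_eval_rf[OF rhom_const_rf generic_sum_diff]
  have "f = subst ?f (varX + varY) (varX - varY)"
    by (simp add: subst_subst[OF generic_sum_diff] rhom_divide[OF S] rhom.simps[OF S] eval_rf_XY)
  thus ?thesis unfolding ratio_def
    using assms homogeneous_X homogeneous_Y
    by (intro homogeneous_0_rational_in_quotient[OF _ _ generic_sum_diff] homogeneous_add homogeneous_diff)
qed

lemma ratio_props: "homogeneous 0 ratio" "transcendental ratio" "sigma ratio = - ratio" "ratio \<noteq> 0"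
proof -
  show "homogeneous 0 ratio" unfolding ratio_def
    using homogeneous_divide[of 0 1 "varX - varY" "varX + varY"] homogeneous_X homogeneous_Y
      homogeneous_add homogeneous_diff by simp
  show "transcendental ratio" unfolding ratio_def by (rule generic_transcendental[OF generic_sum_diff])
  show "sigma ratio = - ratio"
    by (simp add: ratio_def rhom_divide[OF rhom_sigma] rhom.simps[OF rhom_sigma] add.commute)
      (metis minus_diff_eq minus_divide_left)
  show "ratio \<noteq> 0" using XY_nonzero X_neq_Y by (simp add: ratio_def)
qed

text \<open>Exchanging \<open>x\<close> and \<open>y\<close> is \<open>s \<mapsto> - s\<close> with fixed points \<open>0\<close> and \<open>\<infinity>\<close>. A Moebius map that commutes
with it permutes these two points, so it is a multiple of \<open>s\<close> or of \<open>1 / s\<close>.\<close>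

lemma odd_moebius:
  assumes "r = (const_rf a * ratio + const_rf b) / (const_rf \<alpha> * ratio + const_rf \<beta>)"
    "r \<noteq> 0" "sigma r = - r"
  shows "\<exists>k. k \<noteq> 0 \<and> (r = const_rf k * ratio \<or> r = const_rf k / ratio)"
proof -
  interpret C: rhom const_rf by (rule rhom_const_rf)
  have C0: "const_rf c = 0 \<longleftrightarrow> c = 0" for c by (rule rhom_eq_0_iff[OF rhom_const_rf])
  define s where "s = ratio"
  have nz: "const_rf a * s + const_rf b \<noteq> 0" "const_rf \<alpha> * s + const_rf \<beta> \<noteq> 0"
    using assms(1,2) by (auto simp: s_def)
  have sr: "sigma r = (- const_rf a * s + const_rf b) / (- const_rf \<alpha> * s + const_rf \<beta>)"
    unfolding assms(1) s_def
    by (simp add: rhom_divide[OF rhom_sigma] rhom.simps[OF rhom_sigma] ratio_props)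
  hence nz2: "- const_rf \<alpha> * s + const_rf \<beta> \<noteq> 0" using assms(2,3) by auto
  have "(- const_rf a * s + const_rf b) / (- const_rf \<alpha> * s + const_rf \<beta>) =
     - ((const_rf a * s + const_rf b) / (const_rf \<alpha> * s + const_rf \<beta>))"
    using sr assms(3) by (simp add: assms(1) s_def)
  hence "2 * (const_rf a * const_rf \<alpha> * s * s - const_rf b * const_rf \<beta>) = 0"
    using nz2 nz(2) by (simp add: minus_divide_left frac_eq_eq) algebra
  hence "const_rf a * const_rf \<alpha> * s * s - const_rf b * const_rf \<beta> = 0" by simp
  hence "poly (map_poly const_rf [:- (b * \<beta>), 0, a * \<alpha>:]) s = 0"
    by (simp add: map_poly_pCons C.simps algebra_simps)
  hence "[:- (b * \<beta>), 0, a * \<alpha>:] = 0" using ratio_props(2) unfolding transcendental_def s_def by blast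
  hence *: "b * \<beta> = 0" "a * \<alpha> = 0" by simp_all
  have "s \<noteq> 0" using ratio_props by (simp add: s_def)
  show ?thesis
  proof (cases "a = 0")
    case True
    hence "b \<noteq> 0" "\<beta> = 0" "\<alpha> \<noteq> 0" using nz * by (auto simp: C.zero)
    thus ?thesis using \<open>s \<noteq> 0\<close> True
      by (intro exI[of _ "b / \<alpha>"]) (auto simp: assms(1) rhom_divide[OF rhom_const_rf] C.zero s_def)
  next
    case False
    hence "\<alpha> = 0" "\<beta> \<noteq> 0" "b = 0" using nz * by (auto simp: C.zero)
    thus ?thesis using \<open>s \<noteq> 0\<close> False
      by (intro exI[of _ "a / \<beta>"]) (auto simp: assms(1) rhom_divide[OF rhom_const_rf] C.zero s_def)
  qed
qed

text \<open>Replacing \<open>Q\<close> by \<open>R\<close>, where \<open>1 / R = 1 / Q + d / (2 P)\<close>, composes the conjugating map with a map that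
commutes with \<open>(x, y / (y + 1))\<close>. The shift by \<open>d / 2\<close> is chosen so that \<open>P / R\<close> becomes odd, and then \<open>R\<close> is
symmetric.\<close>

lemma symmetric_conjugating_map:
  assumes l: "one_BIR (P, Q)" and c: "conjugate_rm (P, Q) phi_one (u, v)"
    and sym: "i0_symmetric (u, v)"
  defines "h \<equiv> (\<lambda>f. subst f u v)"
  obtains k R where "k \<noteq> 0" "homogeneous 1 R" "R \<noteq> 0" "sigma R = R" "h R = R / (R + 1)"
    "h P = P" "P = const_rf k * ratio * R \<or> P = const_rf k * R / ratio"
proof -
  note D = conjugate_rmD[OF c]
  note h = rhom_eval_rf[OF rhom_const_rf D(2), folded h_def]
  interpret h: rhom h by (rule h)
  interpret s: rhom sigma by (rule rhom_sigma)
  interpret C: rhom const_rf by (rule rhom_const_rf)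
  have C0: "const_rf c = 0 \<longleftrightarrow> c = 0" for c by (rule rhom_eq_0_iff[OF rhom_const_rf])
  have hd: "h (f / g) = h f / h g" and sd: "sigma (f / g) = sigma f / sigma g" for f g
    by (rule rhom_divide[OF h] rhom_divide[OF rhom_sigma])+
  have hC: "h (const_rf c) = const_rf c" for c by (simp add: h_def)
  have hP: "h P = P" and hQ: "h Q = Q / (Q + 1)" using D(3,4) by (simp_all add: h_def)
  have hom: "homogeneous 1 P" "homogeneous 1 Q" using l by (simp_all add: one_BIR_def)
  have nz: "P \<noteq> 0" "Q \<noteq> 0"
    using D(1) eval2_simps(2,3)[OF rhom_const_rf, of P Q] by (force simp: generic_def)+
  have "sigma u = v" "sigma v = u"
    using sym by (auto simp: i0_symmetric_def i0_def comp_rm_pair sigma_def)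
  hence comm: "h (sigma f) = sigma (h f)" for f
    by (simp add: h_def sigma_def subst_subst[OF D(2)] subst_subst[OF generic_YX])
  have fixed: "\<exists>c. f = const_rf c" if f: "homogeneous 0 f" "h f = f" for f
  proof -
    obtain g where "f = subst g P Q" using D(5) by blast
    from homogeneous_0_rational_in_quotient[OF hom D(1) f(1) this] show ?thesis
      by (rule invariant_constant[OF D(1) _ h hC hP hQ f(2)])
  qed
  have homs: "homogeneous 1 (sigma P)" "homogeneous 1 (sigma Q)"
    using hom homogeneous_sigma by blast+
  have "sigma Q \<noteq> 0" using nz rhom_eq_0_iff[OF rhom_sigma] by simp
  have Q1: "Q + 1 \<noteq> 0" using hQ nz rhom_eq_0_iff[OF h, of Q] by auto
  have sQ1: "sigma Q + 1 \<noteq> 0" using Q1 rhom_eq_0_iff[OF rhom_sigma, of "Q + 1"] by (simp add: s.simps)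
  obtain c where "sigma P / P = const_rf c"
    using fixed[of "sigma P / P"] homogeneous_divide[of 0 1 "sigma P" P] homs hom
    by (auto simp: hd comm hP)
  hence sP: "sigma P = const_rf c * P" using nz by (simp add: field_simps)
  have "h (P / sigma Q - P / Q) = P / (sigma Q / (sigma Q + 1)) - P / (Q / (Q + 1))"
    by (simp add: hd h.simps comm hP hQ sd s.simps)
  also have "\<dots> = P / sigma Q - P / Q"
    using nz \<open>sigma Q \<noteq> 0\<close> Q1 sQ1 by (simp add: field_simps)
  finally obtain d where d: "P / sigma Q - P / Q = const_rf d"
    using fixed[of "P / sigma Q - P / Q"] homogeneous_divide[of 0 1 P "sigma Q"]
      homogeneous_divide[of 0 1 P Q] homogeneous_diff homs hom by auto
  have "P = sigma (sigma P)" by simp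
  also have "\<dots> = sigma (const_rf c * P)" by (simp only: sP)
  also have "\<dots> = const_rf c * (const_rf c * P)" by (simp only: s.mult sigma_simps sP)
  finally have cc: "P = const_rf c * (const_rf c * P)" .
  have "const_rf (c * c - 1) * P = const_rf c * (const_rf c * P) - P"
    by (simp add: C.simps algebra_simps)
  also have "\<dots> = 0" by (rule iffD2[OF right_minus_eq]) (rule cc[symmetric])
  finally have "const_rf (c * c - 1) * P = 0" .
  hence "c * c = 1" using nz by (simp add: C0)
  hence c: "c = 1 \<or> c = -1" by (simp add: square_eq_1_iff)
  have "sigma (P / sigma Q - P / Q) = const_rf d" by (simp add: d)
  hence d2: "const_rf c * P / Q - const_rf c * P / sigma Q = const_rf d"
    by (simp add: s.simps sd sP)
  \<comment> \<open>For \<open>c = 1\<close> the exchange of \<open>x\<close> and \<open>y\<close> would fix \<open>P\<close> and \<open>Q\<close>, and therefore all of \<open>K\<close>.\<close>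
  have "c \<noteq> 1"
  proof
    assume "c = 1"
    hence "P / Q - P / sigma Q = const_rf d" using d2 by (simp add: C.one)
    hence "const_rf (d + d) = 0" using d by (simp add: C.simps algebra_simps)
    hence "d = 0" by (simp add: C0)
    hence "sigma Q = Q" using d nz \<open>sigma Q \<noteq> 0\<close> by (simp add: C.zero frac_eq_eq)
    moreover have "sigma P = P" using sP \<open>c = 1\<close> by (simp add: C.one)
    moreover obtain g where "varX = subst g P Q" using D(5) by blast
    ultimately have "sigma varX = varX"
      using eval_rf_hom[OF rhom_sigma rhom_const_rf, of g P Q] by simp
    thus False using X_neq_Y by simp
  qed
  with c sP have sP: "sigma P = - P" by (simp add: C.uminus C.one)
  define t where "t = Q / P"
  define r where "r = P / Q + const_rf (d / 2)"
  have "P / sigma Q = P / Q + const_rf d" using d by (simp add: algebra_simps)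
  moreover have "const_rf d = const_rf (d / 2) + const_rf (d / 2)"
    by (simp flip: C.add)
  moreover have "sigma r = - (P / sigma Q) + const_rf (d / 2)"
    by (simp add: r_def s.simps sd sP)
  ultimately have sr: "sigma r = - r" by (simp add: r_def)
  have t_hom: "homogeneous 0 t"
    using homogeneous_divide[of 0 1 Q P] hom by (simp add: t_def)
  obtain g where "ratio = subst g P Q" using D(5) by blast
  from homogeneous_0_rational_in_quotient[OF hom D(1) ratio_props(1) this]
  have "ratio \<in> ratfuns_of t" by (simp add: t_def)
  from moebius_if_mutually_rational[OF ratio_props(2) homogeneous_0_ratfuns_of_ratio[OF t_hom] this]
  obtain \<alpha> \<beta> \<gamma> \<delta> where t: "const_rf \<gamma> * ratio + const_rf \<delta> \<noteq> 0"
    "t = (const_rf \<alpha> * ratio + const_rf \<beta>) / (const_rf \<gamma> * ratio + const_rf \<delta>)" by blast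
  have "t \<noteq> 0" using nz by (simp add: t_def)
  hence t2: "const_rf \<alpha> * ratio + const_rf \<beta> \<noteq> 0" using t by auto
  have "r = 1 / t + const_rf (d / 2)" by (simp add: r_def t_def)
  also have "\<dots> = (const_rf \<gamma> * ratio + const_rf \<delta> + const_rf (d / 2) * (const_rf \<alpha> * ratio + const_rf \<beta>)) /
      (const_rf \<alpha> * ratio + const_rf \<beta>)"
    using t2 by (simp add: t(2) divide_add_eq_iff)
  also have "const_rf \<gamma> * ratio + const_rf \<delta> + const_rf (d / 2) * (const_rf \<alpha> * ratio + const_rf \<beta>)
      = const_rf (\<gamma> + d / 2 * \<alpha>) * ratio + const_rf (\<delta> + d / 2 * \<beta>)"
    by (simp only: C.add C.mult) (simp only: algebra_simps)
  finally have r: "r = (const_rf (\<gamma> + d / 2 * \<alpha>) * ratio + const_rf (\<delta> + d / 2 * \<beta>)) /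
      (const_rf \<alpha> * ratio + const_rf \<beta>)" .
  have "r \<noteq> 0"
  proof
    assume "r = 0"
    hence "poly (map_poly const_rf [:1, d / 2:]) t = 0"
      using nz by (simp add: r_def t_def map_poly_pCons C.simps field_simps)
    thus False using generic_transcendental[OF D(1)] unfolding t_def transcendental_def by fastforce
  qed
  obtain k where k: "k \<noteq> 0" "r = const_rf k * ratio \<or> r = const_rf k / ratio"
    using odd_moebius[OF r \<open>r \<noteq> 0\<close> sr] by blast
  define R where "R = P / r"
  have "homogeneous 0 r"
    unfolding r_def using homogeneous_add homogeneous_const homogeneous_divide[of 0 1 P Q] hom by simp
  hence "homogeneous 1 R" unfolding R_def using homogeneous_divide[of 1 0 P r] hom by simp
  moreover have "R \<noteq> 0" using nz \<open>r \<noteq> 0\<close> by (simp add: R_def)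
  moreover have "sigma R = R" by (simp add: R_def sd sP sr)
  moreover have "P / (Q / (Q + 1)) = P / Q + P" using nz by (simp add: field_simps)
  hence "h r = r + P" by (simp add: r_def h.simps hd hP hQ hC)
  hence "h R = P / (r + P)" by (simp add: R_def hd hP)
  hence "h R = R / (R + 1)" using \<open>r \<noteq> 0\<close> nz by (simp add: R_def field_simps)
  moreover have "P = const_rf k * ratio * R \<or> P = const_rf k * R / ratio"
    using k(2) \<open>r \<noteq> 0\<close> by (auto simp: R_def)
  ultimately show thesis using that[OF k(1) _ _ _ _ hP] by blast
qed

text \<open>Scaling by the symmetric function \<open>A = R / (x + y)\<close> carries \<open>x + y\<close> to \<open>R\<close> and \<open>x - y\<close> to \<open>U = s R\<close>. Here \<open>U\<close> is
\<open>P / k\<close> or \<open>k R\<^sup>2 / P\<close>, so the action of \<open>\<psi>\<close> on \<open>R\<close> and \<open>U\<close>, and hence on \<open>xA\<close> and \<open>yA\<close>, is known.\<close>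

lemma symmetric_level_one_classification:
  assumes l: "one_BIR (P, Q)" and c: "conjugate_rm (P, Q) phi_one (u, v)"
    and sym: "i0_symmetric (u, v)"
  shows "\<exists>\<phi>\<in>{Phi1, Phi1'}. \<exists>A. A \<noteq> 0 \<and> homogeneous 0 A \<and> sigma A = A \<and>
    conjugate_rm (varX * A, varY * A) \<phi> (u, v)"
proof -
  define h where "h = (\<lambda>f. subst f u v)"
  obtain k R where k: "k \<noteq> 0" "homogeneous 1 R" "R \<noteq> 0" "sigma R = R" "h R = R / (R + 1)"
    "h P = P" "P = const_rf k * ratio * R \<or> P = const_rf k * R / ratio"
    using symmetric_conjugating_map[OF l c sym] unfolding h_def by blast
  have uv: "generic const_rf u v" using conjugate_rmD[OF c] by blast
  note h = rhom_eval_rf[OF rhom_const_rf uv, folded h_def]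
  interpret h: rhom h by (rule h)
  have hd: "h (f / g) = h f / h g" for f g by (rule rhom_divide[OF h])
  have hC: "h (const_rf c) = const_rf c" for c by (simp add: h_def)
  have C0: "const_rf k \<noteq> 0" using k(1) by (simp add: rhom_eq_0_iff[OF rhom_const_rf])
  define A where "A = R / (varX + varY)"
  define U where "U = ratio * R"
  have A: "A \<noteq> 0" "homogeneous 0 A" "sigma A = A"
    using k XY_nonzero homogeneous_divide[of 0 1 R "varX + varY"] homogeneous_X homogeneous_Y homogeneous_add
    by (simp_all add: A_def rhom_divide[OF rhom_sigma] rhom.simps[OF rhom_sigma] add.commute)
  have "(varX + varY) * A = R" "(varX - varY) * A = U"
    using XY_nonzero by (simp_all add: A_def U_def ratio_def)
  hence sum: "varX * A + varY * A = R" and diff: "varX * A - varY * A = U"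
    by (simp_all only: distrib_right left_diff_distrib)
  hence xy: "varX * A = (R + U) / 2" "varY * A = (R - U) / 2" by (simp_all add: field_simps)
  have R1: "R + 1 \<noteq> 0" using k(3,5) rhom_eq_0_iff[OF h, of R] by auto
  let ?X = "varX * A" and ?Y = "varY * A"
  have conj: "conjugate_rm (?X, ?Y) (f, g) (u, v)"
    if "takes const_rf f ?X ?Y (h ?X)" "takes const_rf g ?X ?Y (h ?Y)" for f g
    using that
    by (intro conjugate_rmI[OF inverse_rm_scaling[OF A(1,2)] uv]) (auto simp: h_def dest: takes_eval[OF rhom_const_rf])
  note CI = takes_intros[OF rhom_const_rf]
  from k(7) show ?thesis
  proof
    assume "P = const_rf k * ratio * R"
    hence "U = P / const_rf k" using C0 by (simp add: U_def)
    hence hU: "h U = U" by (simp add: hd hC k)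
    have "conjugate_rm (?X, ?Y) Phi1' (u, v)"
      unfolding Phi1'_def Let_def
    proof (rule conj)
      have "takes const_rf ((varX\<^sup>2 - varY\<^sup>2 + 2 * varX) / (2 * (varX + varY + 1))) ?X ?Y
        ((?X\<^sup>2 - ?Y\<^sup>2 + 2 * ?X) / (2 * (?X + ?Y + 1)))"
        "takes const_rf ((varY\<^sup>2 - varX\<^sup>2 + 2 * varY) / (2 * (varX + varY + 1))) ?X ?Y
        ((?Y\<^sup>2 - ?X\<^sup>2 + 2 * ?Y) / (2 * (?X + ?Y + 1)))"
        using R1 by (intro CI; simp add: sum)+
      moreover have "(?X\<^sup>2 - ?Y\<^sup>2 + 2 * ?X) / (2 * (?X + ?Y + 1)) = h ?X"
        "(?Y\<^sup>2 - ?X\<^sup>2 + 2 * ?Y) / (2 * (?X + ?Y + 1)) = h ?Y"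
        unfolding xy using R1 by (simp_all add: h.simps hd hU k field_simps power2_eq_square)
      ultimately show "takes const_rf ((varX\<^sup>2 - varY\<^sup>2 + 2 * varX) / (2 * (varX + varY + 1))) ?X ?Y (h ?X)"
        "takes const_rf ((varY\<^sup>2 - varX\<^sup>2 + 2 * varY) / (2 * (varX + varY + 1))) ?X ?Y (h ?Y)"
        by simp_all
    qed
    thus ?thesis using A by blast
  next
    assume "P = const_rf k * R / ratio"
    hence U: "U = const_rf k * R\<^sup>2 / P" using C0 k(3) by (simp add: U_def power2_eq_square)
    define D where "D = (R + 1)\<^sup>2"
    have "D \<noteq> 0" using R1 by (simp add: D_def)
    have hU: "h U = U / D" unfolding U D_def by (simp add: hd hC k h.simps power_divide)
    have "R\<^sup>2 + R = R * (R + 1)" by (simp add: algebra_simps power2_eq_square)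
    moreover have "h R = R * (R + 1) / D"
      using R1 by (simp add: k(5) D_def power2_eq_square)
    ultimately have hR: "h R = (R\<^sup>2 + R) / D" by (simp only:)
    have "conjugate_rm (?X, ?Y) Phi1 (u, v)"
      unfolding Phi1_def Let_def
    proof (rule conj)
      have "takes const_rf (((varX + varY)\<^sup>2 + 2 * varX) / (2 * (varX + varY + 1)\<^sup>2)) ?X ?Y
        (((?X + ?Y)\<^sup>2 + 2 * ?X) / (2 * (?X + ?Y + 1)\<^sup>2))"
        "takes const_rf (((varX + varY)\<^sup>2 + 2 * varY) / (2 * (varX + varY + 1)\<^sup>2)) ?X ?Y
        (((?X + ?Y)\<^sup>2 + 2 * ?Y) / (2 * (?X + ?Y + 1)\<^sup>2))"
        using R1 by (intro CI; simp add: sum)+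
      moreover have "((?X + ?Y)\<^sup>2 + 2 * ?X) / (2 * (?X + ?Y + 1)\<^sup>2) = h ?X"
        "((?X + ?Y)\<^sup>2 + 2 * ?Y) / (2 * (?X + ?Y + 1)\<^sup>2) = h ?Y"
        unfolding sum D_def[symmetric] unfolding xy using \<open>D \<noteq> 0\<close>
        by (simp_all add: h.simps hd hU hR field_simps)
      ultimately show "takes const_rf (((varX + varY)\<^sup>2 + 2 * varX) / (2 * (varX + varY + 1)\<^sup>2)) ?X ?Y (h ?X)"
        "takes const_rf (((varX + varY)\<^sup>2 + 2 * varY) / (2 * (varX + varY + 1)\<^sup>2)) ?X ?Y (h ?Y)"
        by simp_all
    qed
    thus ?thesis using A by blast
  qed
qed

section \<open>Conjugates by 1-BIRs satisfy the flow equation\<close>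

lemma generic_nonzero:
  assumes "rhom h" "generic h a b"
  shows "a \<noteq> 0" "b \<noteq> 0" "b + 1 \<noteq> 0"
proof -
  note S = rhom_eval_rf[OF assms]
  have eq: "eval_rf h varX a b = a" "eval_rf h varY a b = b"
    using takes_X[OF assms(1)] takes_Y[OF assms(1)] takes_eval[OF assms(1)] by blast+
  have "takes (\<lambda>c. c) (varY + 1) 0 0 (0 + 1)" by (intro takes_intros rhom_id)
  hence "varY + 1 \<noteq> 0" by (rule nonzero_at_point) simp
  thus "a \<noteq> 0" "b \<noteq> 0" "b + 1 \<noteq> 0"
    using rhom_eq_0_iff[OF S, of varX] rhom_eq_0_iff[OF S, of varY] rhom_eq_0_iff[OF S, of "varY + 1"]
    by (simp_all add: eq rhom.simps[OF S])
qed

text \<open>Homogeneity is an identity over \<open>K(z)\<close>, whereas here \<open>w\<close> is an element of the field of values. As \<open>f / x\<close> is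
rational in \<open>y / x\<close>, the claim follows from \<open>bw / (aw) = b / a\<close>.\<close>

lemma eval_rf_homogeneous:
  assumes f: "homogeneous 1 f" and h: "rhom h"
    and g: "generic h a b" "generic h (a * w) (b * w)"
  shows "eval_rf h f (a * w) (b * w) = w * eval_rf h f a b"
proof -
  have "homogeneous 0 (f / varX)"
    using homogeneous_divide[of 0 1 f varX] f homogeneous_X by simp
  hence "f / varX \<in> ratfuns_of (varY / varX)"
    by (rule homogeneous_0_rational_in_quotient[OF homogeneous_X homogeneous_Y generic_XY])
      (simp add: eval_rf_XY)
  then obtain p q where pq: "f / varX = poly (map_poly const_rf p) (varY / varX) /
    poly (map_poly const_rf q) (varY / varX)"
    by (auto simp: ratfuns_of_def)
  have *: "eval_rf h f a b = a * (poly (map_poly h p) (b / a) / poly (map_poly h q) (b / a))"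
    if g: "generic h a b" for a b
  proof -
    note S = rhom_eval_rf[OF h g]
    have "takes h varX a b a" "takes h (varY / varX) a b (b / a)"
      using generic_nonzero[OF h g] by (auto intro!: takes_intros[OF h])
    hence "eval_rf h varX a b = a"
      "eval_rf h (poly (map_poly const_rf p) (varY / varX)) a b = poly (map_poly h p) (b / a)" for p
      using takes_poly[OF h] takes_eval[OF h] by blast+
    moreover have "f = varX * (f / varX)" by simp
    ultimately show ?thesis unfolding pq
      by (metis rhom.mult[OF S] rhom_divide[OF S])
  qed
  have "b * w / (a * w) = b / a" using generic_nonzero[OF h g(2)] by simp
  with *[OF g(1)] *[OF g(2)] show ?thesis by (simp add: mult_ac)
qed

lemma homogeneous_1_if_quotient:
  assumes "homogeneous 0 (f / varX)"
  shows "homogeneous 1 f"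
  using homogeneous_mult[OF homogeneous_X assms] by simp

text \<open>If \<open>f(P, Q)\<close> is 1-homogeneous then \<open>(f / x)(P, Q)\<close> is 0-homogeneous, hence rational in \<open>Q / P\<close>. Since substitution
of \<open>(P, Q)\<close> is injective, \<open>f / x\<close> is the same rational expression in \<open>y / x\<close>.\<close>

lemma homogeneous_inverse_rm:
  assumes "inverse_rm (P, Q) (c, d)" "homogeneous 1 P" "homogeneous 1 Q"
  shows "homogeneous 1 c" "homogeneous 1 d"
proof -
  have PQ: "generic const_rf P Q" using inverse_rm_generic[OF assms(1)] .
  note S = rhom_eval_rf[OF rhom_const_rf PQ]
  have sub: "subst c P Q = varX" "subst d P Q = varY"
    using assms(1) by (simp_all add: inverse_rm_pair takes_iff[OF rhom_const_rf])
  have *: "homogeneous 1 f" if f: "homogeneous 1 (subst f P Q)" for f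
  proof (rule homogeneous_1_if_quotient)
    have "homogeneous 0 (subst f P Q / P)"
      using homogeneous_divide[of 0 1 "subst f P Q" P] f assms by simp
    hence "subst (f / varX) P Q \<in> ratfuns_of (Q / P)"
      by (intro homogeneous_0_rational_in_quotient[OF assms(2,3) PQ, of _ "f / varX"])
        (simp_all add: rhom_divide[OF S])
    then obtain p q where pq: "subst (f / varX) P Q =
      poly (map_poly const_rf p) (Q / P) / poly (map_poly const_rf q) (Q / P)"
      "poly (map_poly const_rf q) (Q / P) \<noteq> 0"
      by (auto simp: ratfuns_of_def)
    let ?e = "\<lambda>p. poly (map_poly const_rf p) (varY / varX)"
    have e: "subst (?e r) P Q = poly (map_poly const_rf r) (Q / P)" for r
      by (simp add: subst_eval_poly[OF PQ] rhom_divide[OF S])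
    have "subst (f / varX) P Q = subst (?e p / ?e q) P Q"
      by (subst rhom_divide[OF S, of "?e p" "?e q"]) (simp only: e pq(1))
    hence "f / varX = ?e p / ?e q" by (simp only: rhom_eq_iff[OF S])
    moreover have "?e q \<noteq> 0" using pq(2) e[of q] rhom_eq_0_iff[OF S] by metis
    ultimately have "f / varX \<in> ratfuns_of (varY / varX)" by (auto simp: ratfuns_of_def)
    moreover have "homogeneous 0 (varY / varX)"
      using homogeneous_divide[of 0 1 varY varX] homogeneous_X homogeneous_Y by simp
    ultimately show "homogeneous 0 (f / varX)" using homogeneous_ratfuns_of by blast
  qed
  show "homogeneous 1 c" "homogeneous 1 d"
    by (rule *; simp only: sub homogeneous_X homogeneous_Y)+
qed

text \<open>Let \<open>(c, d)\<close> be the inverse of \<open>(P, Q)\<close>. At a generic point \<open>(X, Y)\<close> the flow maps the point with coordinates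
\<open>c(X, Y), d(X, Y)\<close> to \<open>c(X, Y / (Y + 1)), d(X, Y / (Y + 1))\<close>. By homogeneity, the inner side \<open>\<phi>(xz, yz) (1 - z) / z\<close> of
the flow equation is the image under \<open>(c, d)\<close> of \<open>a = (1 - z) P\<close>, \<open>b = (1 - z) Q / (zQ + 1)\<close>. The equation then reduces to
\<open>b / (b + 1) = (1 - z) Q / (Q + 1)\<close>, the one-parameter group law of \<open>Y / (tY + 1)\<close>. The points that involve
\<open>z\<close> are generic because their specialisations at \<open>z = 0\<close> or \<open>z = 1\<close> are.\<close>

lemma flow_equation_conjugate_phi_one:
  assumes l: "one_BIR (P, Q)" and c: "conjugate_rm (P, Q) phi_one (u, v)"
  shows "flow_equation (u, v)"
proof -
  obtain c d where m: "inverse_rm (P, Q) (c, d)"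
    and u: "u = subst c P (Q / (Q + 1))" and v: "v = subst d P (Q / (Q + 1))"
    and G: "generic const_rf P (Q / (Q + 1))"
    using conjugate_rmE[OF c] by metis
  have PQ: "generic const_rf P Q" and cd: "generic const_rf c d"
    using inverse_rm_generic m inverse_rm_sym by blast+
  have hom: "homogeneous 1 P" "homogeneous 1 Q" using l by (simp_all add: one_BIR_def)
  note hcd = homogeneous_inverse_rm[OF m hom]
  note Sm = rhom_eval_rf[OF rhom_const_rf cd]
  have um: "subst u c d = subst c varX (varY / (varY + 1))"
    and vm: "subst v c d = subst d varX (varY / (varY + 1))"
    using m unfolding u v
    by (simp_all add: subst_subst[OF cd] rhom_divide[OF Sm] rhom.simps[OF Sm] inverse_rm_pair takes_iff[OF rhom_const_rf])
  let ?E = "eval_rf const3"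
  have push: "?E (subst f a b) x y = ?E f (?E a x y) (?E b x y)" if "generic const3 x y" for f a b x y
    using eval_rf_hom[OF rhom_eval_rf[OF rhom_const3 that] rhom_const_rf, of f a b]
    by (simp add: takes_eval[OF rhom_const3 takes_const[OF rhom_const3]])
  have after: "?E u (?E c x y) (?E d x y) = ?E c x (y / (y + 1))"
    "?E v (?E c x y) (?E d x y) = ?E d x (y / (y + 1))"
    "generic const3 (?E c x y) (?E d x y)" if xy: "generic const3 x y" for x y
  proof -
    note S = rhom_eval_rf[OF rhom_const3 xy]
    have XY: "?E varX x y = x" "?E varY x y = y"
      using takes_eval[OF rhom_const3 takes_X[OF rhom_const3]]
        takes_eval[OF rhom_const3 takes_Y[OF rhom_const3]] by blast+
    show "?E u (?E c x y) (?E d x y) = ?E c x (y / (y + 1))"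
      "?E v (?E c x y) (?E d x y) = ?E d x (y / (y + 1))"
      by (simp_all add: push[OF xy, symmetric] um vm)
        (simp_all add: push[OF xy] XY rhom_divide[OF S] rhom.simps[OF S])
    show "generic const3 (?E c x y) (?E d x y)"
      using generic_hom[OF S rhom_const_rf cd]
      by (simp add: takes_eval[OF rhom_const3 takes_const[OF rhom_const3]])
  qed
  define p q where "p = lift3 P" and "q = lift3 Q"
  note vz = value_at_intros[OF rhom_poly] value_at_poly_point
  have nz: "Q \<noteq> 0" "P \<noteq> 0" "Q + 1 \<noteq> 0" using generic_nonzero[OF rhom_const_rf PQ] by auto
  have gen0: "generic const3 (p * varZ) (q * varZ / (q * varZ + 1))"
  proof (rule generic_of_value_at[OF rhom_poly rhom_const3 rhom_const_rf])
    show "value_at (\<lambda>p. poly p 1) (p * varZ) (P * 1)"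
      "value_at (\<lambda>p. poly p 1) (q * varZ / (q * varZ + 1)) (Q * 1 / (Q * 1 + 1))"
      unfolding p_def q_def using nz by (intro vz; simp)+
  qed (use G value_at_poly_point in auto)
  have gen1: "generic const3 (p * (1 - varZ)) (q * (1 - varZ) / (q * varZ + 1))"
  proof (rule generic_of_value_at[OF rhom_poly rhom_const3 rhom_const_rf])
    show "value_at (\<lambda>p. poly p 0) (p * (1 - varZ)) (P * (1 - 0))"
      "value_at (\<lambda>p. poly p 0) (q * (1 - varZ) / (q * varZ + 1)) (Q * (1 - 0) / (Q * 0 + 1))"
      unfolding p_def q_def by (intro vz; simp)+
  qed (use PQ value_at_poly_point in auto)
  have gen2: "generic const3 p (q / (q + 1))"
    using generic_hom[OF rhom_lift3 rhom_const_rf G]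
    by (simp add: p_def q_def const3_def[abs_def] rhom_divide[OF rhom_lift3] rhom.simps[OF rhom_lift3])
  have gen3: "generic const3 (p * (1 - varZ)) (q / (q + 1) * (1 - varZ))"
  proof (rule generic_of_value_at[OF rhom_poly rhom_const3 rhom_const_rf])
    show "value_at (\<lambda>p. poly p 0) (p * (1 - varZ)) (P * (1 - 0))"
      "value_at (\<lambda>p. poly p 0) (q / (q + 1) * (1 - varZ)) (Q / (Q + 1) * (1 - 0))"
      unfolding p_def q_def using nz by (intro vz; simp)+
  qed (use G value_at_poly_point in auto)
  have scale: "scale_rf (subst f P (Q / (Q + 1))) = ?E f (p * varZ) (q * varZ / (q * varZ + 1))" for f
    using hom by (simp add: eval_rf_hom[OF rhom_scale_rf rhom_const_rf] rhom_divide[OF rhom_scale_rf]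
      rhom.simps[OF rhom_scale_rf] homogeneous_def p_def q_def mult.commute)
  have lift: "lift3 (subst f P (Q / (Q + 1))) = ?E f p (q / (q + 1))" for f
    by (simp add: eval_rf_hom[OF rhom_lift3 rhom_const_rf] rhom_divide[OF rhom_lift3]
      rhom.simps[OF rhom_lift3] p_def q_def const3_def[abs_def])
  have q1: "q + 1 \<noteq> 0" using generic_nonzero[OF rhom_const3 gen2]
    by auto
  have z1: "1 - varZ \<noteq> 0" and qz: "q * varZ + 1 \<noteq> 0"
    using generic_nonzero[OF rhom_const3 gen1] by auto
  define a b where "a = p * (1 - varZ)" and "b = q * (1 - varZ) / (q * varZ + 1)"
  have ab: "p * varZ * ((1 - varZ) / varZ) = a"
    "q * varZ / (q * varZ + 1) * ((1 - varZ) / varZ) = b"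
    by (simp_all add: a_def b_def)
  have "b + 1 = (q * (1 - varZ) + (q * varZ + 1)) / (q * varZ + 1)"
    using qz by (simp add: b_def add_divide_distrib)
  also have "q * (1 - varZ) + (q * varZ + 1) = q + 1" by (simp add: algebra_simps)
  finally have "b + 1 = (q + 1) / (q * varZ + 1)" .
  hence bb: "b / (b + 1) = q / (q + 1) * (1 - varZ)"
    using qz by (simp add: b_def)
  have gab: "generic const3 a b" using gen1 by (simp add: a_def b_def)
  have scaled: "scale_rf (subst f P (Q / (Q + 1))) * ((1 - varZ) / varZ) = ?E f a b"
    if "homogeneous 1 f" for f
    using eval_rf_homogeneous[OF that rhom_const3 gen0, of "(1 - varZ) / varZ", unfolded ab, OF gab]
    by (simp only: scale mult.commute)
  have lifted: "(1 - varZ) * lift3 (subst f P (Q / (Q + 1))) = ?E f a (b / (b + 1))"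
    if "homogeneous 1 f" for f
    using eval_rf_homogeneous[OF that rhom_const3 gen2 gen3]
    by (simp add: bb lift a_def)
  have su: "scale_rf u * ((1 - varZ) / varZ) = ?E c a b"
    and sv: "scale_rf v * ((1 - varZ) / varZ) = ?E d a b"
    using scaled hcd unfolding u v by blast+
  have lu: "(1 - varZ) * lift3 u = ?E c a (b / (b + 1))"
    and lv: "(1 - varZ) * lift3 v = ?E d a (b / (b + 1))"
    using lifted hcd unfolding u v by blast+
  show ?thesis
    unfolding flow_equation_def Let_def fst_conv snd_conv su sv lu lv
    using after[OF gab] generic_takes[OF rhom_const3 after(3)[OF gab]]
    by (simp add: takes_iff[OF rhom_const3])
qed

section \<open>The four flows\<close>

lemma conjugate_phi_oneI:
  assumes m: "inverse_rm (P, Q) (c, d)"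
    and "takes const_rf c P (Q / (Q + 1)) u" "takes const_rf d P (Q / (Q + 1)) v"
  shows "conjugate_rm (P, Q) phi_one (u, v)"
proof -
  note CI = takes_intros[OF rhom_const_rf]
  have "Q + 1 \<noteq> 0" using generic_nonzero[OF rhom_const_rf inverse_rm_generic[OF m]] by simp
  hence *: "takes const_rf varX P Q P" "takes const_rf (varY / (varY + 1)) P Q (Q / (Q + 1))"
    by (auto intro!: CI)
  have "phi_one \<circ>\<^sub>r (P, Q) = (P, Q / (Q + 1))" "composable phi_one (P, Q)"
    unfolding phi_one_def using comp_rm_takes[OF *] by blast+
  thus ?thesis
    using m comp_rm_takes[OF assms(2,3)] unfolding conjugate_rm_def
    by (intro exI[of _ "(c, d)"]) simp
qed

lemma flow_level_oneI:
  assumes m: "inverse_rm (P, Q) (c, d)" and hom: "homogeneous 1 P" "homogeneous 1 Q"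
    and t: "takes const_rf c P (Q / (Q + 1)) u" "takes const_rf d P (Q / (Q + 1)) v"
    and lim: "flow_limit (u, v)"
  shows "flow_level_one (u, v)"
proof -
  have c: "conjugate_rm (P, Q) phi_one (u, v)" by (rule conjugate_phi_oneI[OF m t])
  have l: "one_BIR (P, Q)" using m hom by (auto simp: one_BIR_def birational_def)
  note nz = generic_nonzero[OF rhom_const_rf conjugate_rmD(1)[OF c]]
  have "(u, v) \<noteq> id_rm"
  proof
    assume "(u, v) = id_rm"
    hence "Q = Q / (Q + 1)"
      using conjugate_rmD(4)[OF c] by (simp add: id_rm_def eval_rf_XY)
    hence "Q * (Q + 1) = Q" using nz by (simp add: eq_divide_eq)
    thus False using nz by (simp add: algebra_simps)
  qed
  with c l lim flow_equation_conjugate_phi_one[OF l c] show ?thesis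
    by (auto simp: flow_level_one_def is_flow_def)
qed

text \<open>Cancelling \<open>z\<close> once, \<open>\<phi>(xz, yz) = z (U, V)\<close> with \<open>U\<close> and \<open>V\<close> continuous at \<open>z = 0\<close>. The polynomial \<open>D\<close> cuts out
the exceptional points \<open>(x, y)\<close>.\<close>

lemma flow_limitI:
  fixes D :: "real poly poly" and U V :: "real \<Rightarrow> real \<Rightarrow> real \<Rightarrow> real"
  assumes "D \<noteq> 0"
    and "\<And>x y. eval2 (\<lambda>c. c) D x y \<noteq> 0 \<Longrightarrow> \<forall>\<^sub>F z in at 0.
      takes (\<lambda>c. c) u (x * z) (y * z) (z * U x y z) \<and> takes (\<lambda>c. c) v (x * z) (y * z) (z * V x y z)"
    and "\<And>x y. eval2 (\<lambda>c. c) D x y \<noteq> 0 \<Longrightarrow> isCont (U x y) 0 \<and> U x y 0 = x"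
    and "\<And>x y. eval2 (\<lambda>c. c) D x y \<noteq> 0 \<Longrightarrow> isCont (V x y) 0 \<and> V x y 0 = y"
  shows "flow_limit (u, v)"
  unfolding flow_limit_def fst_conv snd_conv
proof (intro exI conjI allI impI)
  fix x y assume "eval_pol (\<lambda>c. c) D x y \<noteq> 0"
  hence D: "eval2 (\<lambda>c. c) D x y \<noteq> 0" by (simp add: eval_pol_eval2)
  note ev = assms(2)[OF D]
  show "\<forall>\<^sub>F z in at 0. defined_rf (\<lambda>c. c) u (x * z) (y * z) \<and> defined_rf (\<lambda>c. c) v (x * z) (y * z)"
    using ev by eventually_elim (simp add: takes_iff[OF rhom_id])
  have "\<forall>\<^sub>F z in at 0. (U x y z, V x y z) = (eval_real u (x * z) (y * z) / z, eval_real v (x * z) (y * z) / z)"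
    using ev eventually_neq_at_within[of 0]
    by eventually_elim (simp add: eval_real_def takes_iff[OF rhom_id])
  moreover have "((\<lambda>z. (U x y z, V x y z)) \<longlongrightarrow> (x, y)) (at 0)"
    using assms(3,4)[OF D] by (intro tendsto_Pair) (auto simp: isCont_def)
  ultimately show "((\<lambda>z. (eval_real u (x * z) (y * z) / z, eval_real v (x * z) (y * z) / z)) \<longlongrightarrow> (x, y)) (at 0)"
    by (rule Lim_transform_eventually[rotated])
qed (rule assms(1))

lemma eventually_nonzero_affine:
  fixes a b :: real
  assumes "a \<noteq> 0"
  shows "\<forall>\<^sub>F z in at 0. z \<noteq> 0 \<and> a + b * z \<noteq> 0"
proof (intro eventually_conj eventually_neq_at_within)
  have "((\<lambda>z. a + b * z) \<longlongrightarrow> a + b * 0) (at 0)" by (intro tendsto_intros)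
  thus "\<forall>\<^sub>F z in at 0. a + b * z \<noteq> 0"
    using assms by (intro tendsto_imp_eventually_ne) auto
qed

lemma i0_symmetricI:
  assumes "takes const_rf u varY varX v" "takes const_rf v varY varX u"
  shows "i0_symmetric (u, v)"
  using assms by (simp add: i0_symmetric_def i0_def comp_rm_pair takes_eval[OF rhom_const_rf])

lemma nonzero_polys: "varX + 1 \<noteq> 0" "varY + 1 \<noteq> 0" "varX + varY + 1 \<noteq> 0"
  "varY - varX + varX * (varX + varY) \<noteq> 0" "varX - varY + varY * (varX + varY) \<noteq> 0"
proof -
  have "takes (\<lambda>c. c) (varX + 1) 0 0 (0 + 1)" "takes (\<lambda>c. c) (varY + 1) 0 0 (0 + 1)"
    "takes (\<lambda>c. c) (varX + varY + 1) 0 0 (0 + 0 + 1)"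
    "takes (\<lambda>c. c) (varY - varX + varX * (varX + varY)) 0 1 (1 - 0 + 0 * (0 + 1))"
    "takes (\<lambda>c. c) (varX - varY + varY * (varX + varY)) 1 0 (1 - 0 + 0 * (1 + 0))"
    by (intro takes_intros rhom_id)+
  thus "varX + 1 \<noteq> 0" "varY + 1 \<noteq> 0" "varX + varY + 1 \<noteq> 0"
    "varY - varX + varX * (varX + varY) \<noteq> 0" "varX - varY + varY * (varX + varY) \<noteq> 0"
    using nonzero_at_point by force+
qed

text \<open>The flow acts on \<open>1 / x\<close> and \<open>1 / y\<close> by adding \<open>1\<close>, so \<open>1 / P = 1 / x - 1 / y\<close> is invariant and \<open>Q = y\<close> can be
used for the second coordinate.\<close>

lemma phi_tor1_level_one: "flow_level_one phi_tor1"
  unfolding phi_tor1_def Let_def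
proof (rule flow_level_oneI)
  let ?x = "varX" and ?y = "varY"
  let ?P = "?x * ?y / (?y - ?x)" and ?Q = "?y"
  let ?c = "?x * ?y / (?x + ?y)" and ?d = "?y"
  note CI = takes_intros[OF rhom_const_rf]
  note nz = XY_nonzero X_neq_Y X_neq_Y[symmetric] nonzero_polys
  have n1: "?P + ?Q = ?y * ?y / (?y - ?x)" and n2: "?y - ?c = ?y * ?y / (?x + ?y)"
    using nz by (simp_all add: field_simps)
  have "takes const_rf ?P ?c ?d (?c * ?d / (?d - ?c))" "takes const_rf ?c ?P ?Q (?P * ?Q / (?P + ?Q))"
    using nz n1 n2 by (intro CI; simp)+
  moreover have "?c * ?d / (?d - ?c) = ?x" "?P * ?Q / (?P + ?Q) = ?x"
    unfolding n1 n2 using nz by simp_all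
  ultimately show "inverse_rm (?P, ?Q) (?c, ?d)"
    by (simp add: inverse_rm_pair CI)
  show "homogeneous 1 ?P" "homogeneous 1 ?Q"
    using homogeneous_divide[of 1 1] homogeneous_mult[of 1 _ 1] homogeneous_diff[of 1] homogeneous_X homogeneous_Y
    by blast+
  have "?P + ?Q / (?Q + 1) = (?P * (?Q + 1) + ?Q) / (?Q + 1)" using nz by (simp add: field_simps)
  also have "?P * (?Q + 1) + ?Q = ?y * ?y * (?x + 1) / (?y - ?x)"
    using nz by (simp add: add_divide_eq_iff divide_add_eq_iff) (simp add: algebra_simps)
  finally have n3: "?P + ?Q / (?Q + 1) = ?y * ?y * (?x + 1) / (?y - ?x) / (?Q + 1)" .
  have "takes const_rf ?c ?P (?Q / (?Q + 1)) (?P * (?Q / (?Q + 1)) / (?P + ?Q / (?Q + 1)))"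
    by (intro CI) (use nz n3 in simp)
  also have "?P * (?Q / (?Q + 1)) / (?P + ?Q / (?Q + 1)) = ?x / (?x + 1)"
    unfolding n3 using nz by simp
  finally show "takes const_rf ?c ?P (?Q / (?Q + 1)) (?x / (?x + 1))" .
  show "takes const_rf ?d ?P (?Q / (?Q + 1)) (?y / (?y + 1))" by (rule CI)
  show "flow_limit (?x / (?x + 1), ?y / (?y + 1))"
  proof (rule flow_limitI[of 1 _ "\<lambda>x y z. x / (1 + x * z)" _ "\<lambda>x y z. y / (1 + y * z)"])
    fix x y :: real
    show "\<forall>\<^sub>F z in at 0. takes (\<lambda>c. c) (?x / (?x + 1)) (x * z) (y * z) (z * (x / (1 + x * z))) \<and>
      takes (\<lambda>c. c) (?y / (?y + 1)) (x * z) (y * z) (z * (y / (1 + y * z)))"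
      using eventually_nonzero_affine[OF one_neq_zero, of x] eventually_nonzero_affine[OF one_neq_zero, of y]
    proof eventually_elim
      case (elim z)
      hence "takes (\<lambda>c. c) (?x / (?x + 1)) (x * z) (y * z) (x * z / (x * z + 1))"
        "takes (\<lambda>c. c) (?y / (?y + 1)) (x * z) (y * z) (y * z / (y * z + 1))"
        by (intro takes_intros[OF rhom_id]; simp add: add.commute)+
      thus ?case by (simp add: mult.commute add.commute)
    qed
  qed (auto intro!: continuous_intros)
qed

lemma phi_tor1_symmetric: "i0_symmetric phi_tor1"
  unfolding phi_tor1_def Let_def
  by (rule i0_symmetricI; intro takes_intros[OF rhom_const_rf]; simp add: nonzero_polys)

text \<open>The flow fixes \<open>x - y\<close> and sends \<open>x + y\<close> to \<open>(x + y) / (x + y + 1)\<close>.\<close>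

lemma Phi1'_level_one: "flow_level_one Phi1'"
  unfolding Phi1'_def Let_def
proof (rule flow_level_oneI)
  let ?x = "varX" and ?y = "varY"
  let ?P = "?x - ?y" and ?Q = "?x + ?y"
  let ?c = "(?x + ?y) / 2" and ?d = "(?y - ?x) / 2"
  let ?u = "(?x\<^sup>2 - ?y\<^sup>2 + 2 * ?x) / (2 * (?x + ?y + 1))"
  let ?v = "(?y\<^sup>2 - ?x\<^sup>2 + 2 * ?y) / (2 * (?x + ?y + 1))"
  note CI = takes_intros[OF rhom_const_rf]
  note nz = XY_nonzero nonzero_polys
  have "takes const_rf ?P ?c ?d (?c - ?d)" "takes const_rf ?Q ?c ?d (?c + ?d)"
    "takes const_rf ?c ?P ?Q ((?P + ?Q) / 2)" "takes const_rf ?d ?P ?Q ((?Q - ?P) / 2)"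
    by (intro CI; simp)+
  thus "inverse_rm (?P, ?Q) (?c, ?d)"
    by (simp add: inverse_rm_pair field_simps)
  show "homogeneous 1 ?P" "homogeneous 1 ?Q"
    by (intro homogeneous_diff homogeneous_add homogeneous_X homogeneous_Y)+
  have "takes const_rf ?c ?P (?Q / (?Q + 1)) ((?P + ?Q / (?Q + 1)) / 2)"
    "takes const_rf ?d ?P (?Q / (?Q + 1)) ((?Q / (?Q + 1) - ?P) / 2)"
    by (intro CI; simp)+
  moreover have "(?P + ?Q / (?Q + 1)) / 2 = (?P * (?Q + 1) + ?Q) / (2 * (?Q + 1))"
    "(?Q / (?Q + 1) - ?P) / 2 = (?Q - ?P * (?Q + 1)) / (2 * (?Q + 1))"
    using nz by (simp_all add: add_divide_eq_iff divide_diff_eq_iff)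
  moreover have "?P * (?Q + 1) + ?Q = ?x\<^sup>2 - ?y\<^sup>2 + 2 * ?x" "?Q - ?P * (?Q + 1) = ?y\<^sup>2 - ?x\<^sup>2 + 2 * ?y"
    by (simp_all add: power2_eq_square algebra_simps)
  ultimately show "takes const_rf ?c ?P (?Q / (?Q + 1)) ?u" "takes const_rf ?d ?P (?Q / (?Q + 1)) ?v"
    by simp_all
  show "flow_limit (?u, ?v)"
  proof (rule flow_limitI[of 1 _ "\<lambda>x y z. ((x\<^sup>2 - y\<^sup>2) * z + 2 * x) / (2 * (1 + (x + y) * z))"
        _ "\<lambda>x y z. ((y\<^sup>2 - x\<^sup>2) * z + 2 * y) / (2 * (1 + (x + y) * z))"])
    fix x y :: real
    show "\<forall>\<^sub>F z in at 0.
      takes (\<lambda>c. c) ?u (x * z) (y * z) (z * (((x\<^sup>2 - y\<^sup>2) * z + 2 * x) / (2 * (1 + (x + y) * z)))) \<and>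
      takes (\<lambda>c. c) ?v (x * z) (y * z) (z * (((y\<^sup>2 - x\<^sup>2) * z + 2 * y) / (2 * (1 + (x + y) * z))))"
      using eventually_nonzero_affine[OF one_neq_zero, of "x + y"]
    proof eventually_elim
      case (elim z)
      have den: "x * z + y * z + 1 = 1 + (x + y) * z" by (simp add: algebra_simps)
      have num: "(x * z)\<^sup>2 - (y * z)\<^sup>2 + 2 * (x * z) = z * ((x\<^sup>2 - y\<^sup>2) * z + 2 * x)"
        "(y * z)\<^sup>2 - (x * z)\<^sup>2 + 2 * (y * z) = z * ((y\<^sup>2 - x\<^sup>2) * z + 2 * y)"
        by (simp_all add: power2_eq_square algebra_simps)
      have "takes (\<lambda>c. c) ?u (x * z) (y * z)
          (((x * z)\<^sup>2 - (y * z)\<^sup>2 + 2 * (x * z)) / (2 * (x * z + y * z + 1)))"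
        "takes (\<lambda>c. c) ?v (x * z) (y * z)
          (((y * z)\<^sup>2 - (x * z)\<^sup>2 + 2 * (y * z)) / (2 * (x * z + y * z + 1)))"
        using elim by (intro takes_intros[OF rhom_id]; simp add: den)+
      thus ?case unfolding num den by simp
    qed
  qed (auto intro!: continuous_intros)
qed

lemma Phi1'_symmetric: "i0_symmetric Phi1'"
proof -
  let ?x = "varX" and ?y = "varY"
  have "takes const_rf ((?x\<^sup>2 - ?y\<^sup>2 + 2 * ?x) / (2 * (?x + ?y + 1))) ?y ?x ((?y\<^sup>2 - ?x\<^sup>2 + 2 * ?y) / (2 * (?y + ?x + 1)))"
    "takes const_rf ((?y\<^sup>2 - ?x\<^sup>2 + 2 * ?y) / (2 * (?x + ?y + 1))) ?y ?x ((?x\<^sup>2 - ?y\<^sup>2 + 2 * ?x) / (2 * (?y + ?x + 1)))"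
    using nonzero_polys(3) by (intro takes_intros[OF rhom_const_rf]; simp add: add.commute[of ?y ?x])+
  thus ?thesis
    unfolding Phi1'_def Let_def by (intro i0_symmetricI) (simp_all add: add.commute[of ?y ?x])
qed

text \<open>The flow divides \<open>x + y\<close> by \<open>x + y + 1\<close> and \<open>x - y\<close> by the square of this, so \<open>(x + y)\<^sup>2 / (x - y)\<close> is invariant.\<close>

lemma Phi1_level_one: "flow_level_one Phi1"
  unfolding Phi1_def Let_def
proof (rule flow_level_oneI)
  let ?x = "varX" and ?y = "varY"
  let ?P = "(?x + ?y)\<^sup>2 / (?x - ?y)" and ?Q = "?x + ?y"
  let ?c = "(?y + ?y\<^sup>2 / ?x) / 2" and ?d = "(?y - ?y\<^sup>2 / ?x) / 2"
  let ?u = "((?x + ?y)\<^sup>2 + 2 * ?x) / (2 * (?x + ?y + 1)\<^sup>2)"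
  let ?v = "((?x + ?y)\<^sup>2 + 2 * ?y) / (2 * (?x + ?y + 1)\<^sup>2)"
  note CI = takes_intros[OF rhom_const_rf]
  note nz = XY_nonzero X_neq_Y nonzero_polys
  have cd: "?c + ?d = ?y" "?c - ?d = ?y\<^sup>2 / ?x" by (simp_all add: field_simps)
  have "takes const_rf ?P ?c ?d ((?c + ?d)\<^sup>2 / (?c - ?d))" "takes const_rf ?Q ?c ?d (?c + ?d)"
    by (intro CI; simp add: cd)+
  moreover have QP: "?Q\<^sup>2 / ?P = ?x - ?y" using nz by simp
  have "takes const_rf ?c ?P ?Q ((?Q + ?Q\<^sup>2 / ?P) / 2)" "takes const_rf ?d ?P ?Q ((?Q - ?Q\<^sup>2 / ?P) / 2)"
    using nz by (intro CI; simp)+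
  hence "takes const_rf ?c ?P ?Q ?x" "takes const_rf ?d ?P ?Q ?y"
    unfolding QP by (simp_all add: algebra_simps)
  ultimately show "inverse_rm (?P, ?Q) (?c, ?d)"
    unfolding cd by (simp add: inverse_rm_pair)
  have Q: "homogeneous 1 ?Q" and "homogeneous 1 (?x - ?y)"
    by (intro homogeneous_diff homogeneous_add homogeneous_X homogeneous_Y)+
  thus "homogeneous 1 ?P"
    using homogeneous_divide[of 1 1] homogeneous_mult[OF Q Q] by (simp add: power2_eq_square)
  show "homogeneous 1 ?Q" by (rule Q)
  define N where "N = ?Q + 1"
  have N: "N \<noteq> 0" using nz by (simp add: N_def)
  have "(?Q / N)\<^sup>2 / ?P = (?x - ?y) / N\<^sup>2"
    using nz N by (simp add: power_divide)
  moreover have "takes const_rf ?c ?P (?Q / N) ((?Q / N + (?Q / N)\<^sup>2 / ?P) / 2)"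
    "takes const_rf ?d ?P (?Q / N) ((?Q / N - (?Q / N)\<^sup>2 / ?P) / 2)"
    using nz N by (intro CI; simp)+
  ultimately have "takes const_rf ?c ?P (?Q / N) ((?Q / N + (?x - ?y) / N\<^sup>2) / 2)"
    "takes const_rf ?d ?P (?Q / N) ((?Q / N - (?x - ?y) / N\<^sup>2) / 2)"
    by (simp_all only:)
  moreover have "?Q / N = ?Q * N / N\<^sup>2" using N by (simp add: power2_eq_square)
  hence "(?Q / N + (?x - ?y) / N\<^sup>2) / 2 = (?Q * N + (?x - ?y)) / (2 * N\<^sup>2)"
    "(?Q / N - (?x - ?y) / N\<^sup>2) / 2 = (?Q * N - (?x - ?y)) / (2 * N\<^sup>2)"
    by (simp_all add: add_divide_distrib diff_divide_distrib)
  moreover have "?Q * N + (?x - ?y) = (?x + ?y)\<^sup>2 + 2 * ?x" "?Q * N - (?x - ?y) = (?x + ?y)\<^sup>2 + 2 * ?y"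
    by (simp_all add: N_def power2_eq_square algebra_simps)
  ultimately show "takes const_rf ?c ?P (?Q / (?Q + 1)) ?u" "takes const_rf ?d ?P (?Q / (?Q + 1)) ?v"
    unfolding N_def by (simp_all only:)
  show "flow_limit (?u, ?v)"
  proof (rule flow_limitI[of 1 _ "\<lambda>x y z. ((x + y)\<^sup>2 * z + 2 * x) / (2 * (1 + (x + y) * z)\<^sup>2)"
        _ "\<lambda>x y z. ((x + y)\<^sup>2 * z + 2 * y) / (2 * (1 + (x + y) * z)\<^sup>2)"])
    fix x y :: real
    show "\<forall>\<^sub>F z in at 0.
      takes (\<lambda>c. c) ?u (x * z) (y * z) (z * (((x + y)\<^sup>2 * z + 2 * x) / (2 * (1 + (x + y) * z)\<^sup>2))) \<and>
      takes (\<lambda>c. c) ?v (x * z) (y * z) (z * (((x + y)\<^sup>2 * z + 2 * y) / (2 * (1 + (x + y) * z)\<^sup>2)))"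
      using eventually_nonzero_affine[OF one_neq_zero, of "x + y"]
    proof eventually_elim
      case (elim z)
      have den: "x * z + y * z + 1 = 1 + (x + y) * z" by (simp add: algebra_simps)
      have num: "(x * z + y * z)\<^sup>2 + 2 * (x * z) = z * ((x + y)\<^sup>2 * z + 2 * x)"
        "(x * z + y * z)\<^sup>2 + 2 * (y * z) = z * ((x + y)\<^sup>2 * z + 2 * y)"
        by (simp_all add: power2_eq_square algebra_simps)
      have "takes (\<lambda>c. c) ?u (x * z) (y * z)
          (((x * z + y * z)\<^sup>2 + 2 * (x * z)) / (2 * (x * z + y * z + 1)\<^sup>2))"
        "takes (\<lambda>c. c) ?v (x * z) (y * z)
          (((x * z + y * z)\<^sup>2 + 2 * (y * z)) / (2 * (x * z + y * z + 1)\<^sup>2))"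
        using elim by (intro takes_intros[OF rhom_id]; simp add: den)+
      thus ?case unfolding num den by simp
    qed
  qed (auto intro!: continuous_intros)
qed

lemma Phi1_symmetric: "i0_symmetric Phi1"
proof -
  let ?x = "varX" and ?y = "varY"
  have "takes const_rf (((?x + ?y)\<^sup>2 + 2 * ?x) / (2 * (?x + ?y + 1)\<^sup>2)) ?y ?x (((?y + ?x)\<^sup>2 + 2 * ?y) / (2 * (?y + ?x + 1)\<^sup>2))"
    "takes const_rf (((?x + ?y)\<^sup>2 + 2 * ?y) / (2 * (?x + ?y + 1)\<^sup>2)) ?y ?x (((?y + ?x)\<^sup>2 + 2 * ?x) / (2 * (?y + ?x + 1)\<^sup>2))"
    using nonzero_polys(3) by (intro takes_intros[OF rhom_const_rf]; simp add: add.commute[of ?y ?x])+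
  thus ?thesis
    unfolding Phi1_def Let_def by (intro i0_symmetricI) (simp_all add: add.commute[of ?y ?x])
qed

text \<open>As for the flow \<open>(x / (x + 1), y / (y + 1))\<close>, the difference \<open>1 / x - 1 / y\<close> is invariant, which gives \<open>P\<close> up to sign. The
symmetric choice of the second coordinate is \<open>2 x y (x + y) / (x - y)\<^sup>2\<close>; adding \<open>1 / (2 P)\<close> to its reciprocal gives
\<open>1 / Q\<close> for the \<open>Q\<close> used here, which leads to a simpler inverse map. On the line \<open>x = y\<close> the flow is undefined, hence the exceptional
polynomial \<open>x - y\<close> in the limit.\<close>

lemma Psi_level_one: "flow_level_one Psi"
  unfolding Psi_def Let_def
proof (rule flow_level_oneI)
  let ?x = "varX" and ?y = "varY"
  let ?P = "?x * ?y / (?x - ?y)" and ?Q = "?y * (?x + ?y) / (?x - ?y)"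
  let ?d = "2 * ?x - ?y"
  let ?c = "?d * ?x / (?y - ?x)"
  let ?u = "(2 * ?x\<^sup>2 * ?y * (?x + ?y) + (?x - ?y)\<^sup>2 * ?x) / ((?y - ?x) * (?x\<^sup>2 + ?x * ?y - ?x + ?y))"
  let ?v = "(2 * ?x * ?y\<^sup>2 * (?x + ?y) + (?x - ?y)\<^sup>2 * ?y) / ((?x - ?y) * (?y\<^sup>2 + ?x * ?y - ?y + ?x))"
  note CI = takes_intros[OF rhom_const_rf]
  have "takes (\<lambda>c. c) ?d 0 1 (2 * 0 - 1)" by (intro takes_intros rhom_id)
  hence "?d \<noteq> 0" by (rule nonzero_at_point) simp
  note nz = XY_nonzero X_neq_Y X_neq_Y[symmetric] nonzero_polys this
  have frac: "d * x / e - d = d * (x - e) / e" "d * x / e + d = d * (x + e) / e"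
    if "e \<noteq> 0" for d e x :: ratfun
    using that by (simp_all add: right_diff_distrib distrib_left diff_divide_distrib add_divide_distrib)
  have "?c - ?d = ?d * (?x - (?y - ?x)) / (?y - ?x)" "?c + ?d = ?d * (?x + (?y - ?x)) / (?y - ?x)"
    using frac[of "?y - ?x" ?d ?x] nz by simp_all
  hence cd: "?c - ?d = ?d * ?d / (?y - ?x)" "?c + ?d = ?d * ?y / (?y - ?x)"
    by simp_all
  have "takes const_rf ?P ?c ?d (?c * ?d / (?c - ?d))" "takes const_rf ?Q ?c ?d (?d * (?c + ?d) / (?c - ?d))"
    using nz by (intro CI; simp add: cd)+
  moreover have "?c * ?d / (?c - ?d) = ?x" "?d * (?c + ?d) / (?c - ?d) = ?y"
    unfolding cd using nz by simp_all
  moreover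
  have "2 * ?P - ?Q = (2 * (?x * ?y) - ?y * (?x + ?y)) / (?x - ?y)" "?Q - ?P = (?y * (?x + ?y) - ?x * ?y) / (?x - ?y)"
    by (simp_all add: diff_divide_distrib)
  moreover have "2 * (?x * ?y) - ?y * (?x + ?y) = ?y * (?x - ?y)" "?y * (?x + ?y) - ?x * ?y = ?y * ?y"
    by (simp_all add: algebra_simps)
  ultimately have PQ: "2 * ?P - ?Q = ?y" "?Q - ?P = ?y * ?y / (?x - ?y)"
    and PQ': "takes const_rf ?P ?c ?d ?x" "takes const_rf ?Q ?c ?d ?y"
    using nz by simp_all
  have "takes const_rf ?c ?P ?Q ((2 * ?P - ?Q) * ?P / (?Q - ?P))" "takes const_rf ?d ?P ?Q (2 * ?P - ?Q)"
    using nz PQ(2) by (intro CI; simp)+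
  moreover have "(2 * ?P - ?Q) * ?P / (?Q - ?P) = ?x"
    unfolding PQ using nz by simp
  ultimately show "inverse_rm (?P, ?Q) (?c, ?d)"
    using PQ' PQ by (simp add: inverse_rm_pair)
  have "homogeneous 1 (?x - ?y)" "homogeneous (1 + 1) (?x * ?y)" "homogeneous (1 + 1) (?y * (?x + ?y))"
    by (intro homogeneous_diff homogeneous_add homogeneous_mult homogeneous_X homogeneous_Y)+
  thus "homogeneous 1 ?P" "homogeneous 1 ?Q"
    using homogeneous_divide by blast+
  define s where "s = ?x - ?y"
  define N where "N = ?y - ?x + ?x * (?x + ?y)"
  define M where "M = ?x - ?y + ?y * (?x + ?y)"
  define T where "T = 2 * ?x * ?y * (?x + ?y) + (?x - ?y)\<^sup>2"
  have snz: "s \<noteq> 0" "N \<noteq> 0" "M \<noteq> 0" using nz by (simp_all add: s_def N_def M_def)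
  have "?Q + 1 = M / s" using snz by (simp add: M_def s_def add_divide_distrib)
  hence Q': "?Q / (?Q + 1) = ?y * (?x + ?y) / M" using snz by (simp add: s_def)
  have "2 * ?P - ?y * (?x + ?y) / M = (2 * (?x * ?y) * M - ?y * (?x + ?y) * s) / (s * M)"
    "?y * (?x + ?y) / M - ?P = (?y * (?x + ?y) * s - ?x * ?y * M) / (s * M)"
    using snz by (simp_all add: diff_divide_distrib flip: s_def)
  moreover have "2 * (?x * ?y) * M - ?y * (?x + ?y) * s = ?y * T"
    "?y * (?x + ?y) * s - ?x * ?y * M = - (?y * ?y * N)"
    by (simp_all add: M_def s_def T_def N_def power2_eq_square algebra_simps)
  ultimately have d': "2 * ?P - ?y * (?x + ?y) / M = ?y * T / (s * M)"
    and e': "?y * (?x + ?y) / M - ?P = - (?y * ?y * N) / (s * M)"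
    by (simp_all only:)
  have "takes const_rf ?c ?P (?Q / (?Q + 1)) ((2 * ?P - ?y * (?x + ?y) / M) * ?P / (?y * (?x + ?y) / M - ?P))"
    "takes const_rf ?d ?P (?Q / (?Q + 1)) (2 * ?P - ?y * (?x + ?y) / M)"
    unfolding Q' using e' snz by (intro CI; simp)+
  hence "takes const_rf ?c ?P (?Q / (?Q + 1)) (?y * T / (s * M) * ?P / (- (?y * ?y * N) / (s * M)))"
    "takes const_rf ?d ?P (?Q / (?Q + 1)) (?y * T / (s * M))"
    unfolding d' e' .
  moreover have "?y * T / (s * M) * ?P / (- (?y * ?y * N) / (s * M)) = ?x * T / (- s * N)"
    using snz by (simp flip: s_def)
  moreover have "?x * T = 2 * ?x\<^sup>2 * ?y * (?x + ?y) + (?x - ?y)\<^sup>2 * ?x"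
    "?y * T = 2 * ?x * ?y\<^sup>2 * (?x + ?y) + (?x - ?y)\<^sup>2 * ?y"
    "N = ?x\<^sup>2 + ?x * ?y - ?x + ?y" "M = ?y\<^sup>2 + ?x * ?y - ?y + ?x" "- s = ?y - ?x"
    by (simp_all add: T_def N_def M_def s_def power2_eq_square algebra_simps)
  ultimately show "takes const_rf ?c ?P (?Q / (?Q + 1)) ?u" "takes const_rf ?d ?P (?Q / (?Q + 1)) ?v"
    by (simp_all only: s_def)
  show "flow_limit (?u, ?v)"
  proof (rule flow_limitI[of "[:[:0, 1:], [:-1:]:]"
        _ "\<lambda>x y z. x * (2 * (x * y * (x + y)) * z + (x - y)\<^sup>2) / ((y - x) * ((y - x) + x * (x + y) * z))"
        _ "\<lambda>x y z. y * (2 * (x * y * (x + y)) * z + (x - y)\<^sup>2) / ((x - y) * ((x - y) + y * (x + y) * z))"])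
    fix x y :: real
    assume "eval2 (\<lambda>c. c) [:[:0, 1:], [:-1:]:] x y \<noteq> 0"
    hence xy: "x - y \<noteq> 0" "y - x \<noteq> 0" by (simp_all add: eval2_def map_poly_pCons)
    have sq: "(x - y)\<^sup>2 = (y - x) * (y - x)" by (simp add: power2_eq_square algebra_simps)
    show "isCont (\<lambda>z. x * (2 * (x * y * (x + y)) * z + (x - y)\<^sup>2) / ((y - x) * ((y - x) + x * (x + y) * z))) 0 \<and>
      x * (2 * (x * y * (x + y)) * 0 + (x - y)\<^sup>2) / ((y - x) * ((y - x) + x * (x + y) * 0)) = x"
      using xy unfolding sq by (auto intro!: continuous_intros)
    show "isCont (\<lambda>z. y * (2 * (x * y * (x + y)) * z + (x - y)\<^sup>2) / ((x - y) * ((x - y) + y * (x + y) * z))) 0 \<and>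
      y * (2 * (x * y * (x + y)) * 0 + (x - y)\<^sup>2) / ((x - y) * ((x - y) + y * (x + y) * 0)) = y"
      using xy by (auto intro!: continuous_intros simp: power2_eq_square)
    show "\<forall>\<^sub>F z in at 0.
      takes (\<lambda>c. c) ?u (x * z) (y * z)
        (z * (x * (2 * (x * y * (x + y)) * z + (x - y)\<^sup>2) / ((y - x) * ((y - x) + x * (x + y) * z)))) \<and>
      takes (\<lambda>c. c) ?v (x * z) (y * z)
        (z * (y * (2 * (x * y * (x + y)) * z + (x - y)\<^sup>2) / ((x - y) * ((x - y) + y * (x + y) * z))))"
      using eventually_nonzero_affine[OF xy(2), of "x * (x + y)"]
        eventually_nonzero_affine[OF xy(1), of "y * (x + y)"]
    proof eventually_elim
      case (elim z)
      define a b where "a = x * z" and "b = y * z"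
      have num: "2 * a\<^sup>2 * b * (a + b) + (a - b)\<^sup>2 * a = z ^ 3 * (x * (2 * (x * y * (x + y)) * z + (x - y)\<^sup>2))"
        "2 * a * b\<^sup>2 * (a + b) + (a - b)\<^sup>2 * b = z ^ 3 * (y * (2 * (x * y * (x + y)) * z + (x - y)\<^sup>2))"
        by (simp_all add: a_def b_def power2_eq_square power3_eq_cube algebra_simps)
      have den: "(b - a) * (a\<^sup>2 + a * b - a + b) = z ^ 2 * ((y - x) * ((y - x) + x * (x + y) * z))"
        "(a - b) * (b\<^sup>2 + a * b - b + a) = z ^ 2 * ((x - y) * ((x - y) + y * (x + y) * z))"
        by (simp_all add: a_def b_def power2_eq_square algebra_simps)
      have "takes (\<lambda>c. c) ?u a b ((2 * a\<^sup>2 * b * (a + b) + (a - b)\<^sup>2 * a) / ((b - a) * (a\<^sup>2 + a * b - a + b)))"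
        "takes (\<lambda>c. c) ?v a b ((2 * a * b\<^sup>2 * (a + b) + (a - b)\<^sup>2 * b) / ((a - b) * (b\<^sup>2 + a * b - b + a)))"
        by (intro takes_intros[OF rhom_id]; use elim xy in \<open>simp only: den\<close>; simp)+
      hence "takes (\<lambda>c. c) ?u a b (z ^ 3 * (x * (2 * (x * y * (x + y)) * z + (x - y)\<^sup>2)) / (z ^ 2 * ((y - x) * ((y - x) + x * (x + y) * z))))"
        "takes (\<lambda>c. c) ?v a b (z ^ 3 * (y * (2 * (x * y * (x + y)) * z + (x - y)\<^sup>2)) / (z ^ 2 * ((x - y) * ((x - y) + y * (x + y) * z))))"
        unfolding num den .
      moreover have "z ^ 3 * p / (z ^ 2 * q) = z * (p / q)" for p q
        using elim by (simp add: power2_eq_square power3_eq_cube)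
      ultimately show ?case unfolding a_def b_def by (simp only: times_divide_eq_right)
    qed
  qed simp
qed

lemma Psi_symmetric: "i0_symmetric Psi"
proof -
  let ?x = "varX" and ?y = "varY"
  have nz: "?x\<^sup>2 + ?x * ?y - ?x + ?y \<noteq> 0" "?y\<^sup>2 + ?x * ?y - ?y + ?x \<noteq> 0"
    using nonzero_polys(4,5) by (simp_all add: power2_eq_square algebra_simps)
  have "takes const_rf ((2 * ?x\<^sup>2 * ?y * (?x + ?y) + (?x - ?y)\<^sup>2 * ?x) / ((?y - ?x) * (?x\<^sup>2 + ?x * ?y - ?x + ?y))) ?y ?x
      ((2 * ?y\<^sup>2 * ?x * (?y + ?x) + (?y - ?x)\<^sup>2 * ?y) / ((?x - ?y) * (?y\<^sup>2 + ?y * ?x - ?y + ?x)))"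
    "takes const_rf ((2 * ?x * ?y\<^sup>2 * (?x + ?y) + (?x - ?y)\<^sup>2 * ?y) / ((?x - ?y) * (?y\<^sup>2 + ?x * ?y - ?y + ?x))) ?y ?x
      ((2 * ?y * ?x\<^sup>2 * (?y + ?x) + (?y - ?x)\<^sup>2 * ?x) / ((?y - ?x) * (?x\<^sup>2 + ?y * ?x - ?x + ?y)))"
    using nz X_neq_Y by (intro takes_intros[OF rhom_const_rf]; simp add: mult.commute[of ?y ?x])+
  thus ?thesis
    unfolding Psi_def Let_def
    by (intro i0_symmetricI) (simp_all add: ac_simps power2_commute[of ?y ?x])
qed

theorem proposition14:
  shows "(\<forall>\<phi> \<in> {phi_tor1, Phi1, Phi1', Psi}. flow_level_one \<phi> \<and> i0_symmetric \<phi>) \<and>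
    (\<forall>\<psi>. flow_level_one \<psi> \<and> i0_symmetric \<psi> \<longrightarrow>
      (\<exists>\<phi> \<in> {phi_tor1, Phi1, Phi1', Psi}. \<exists>A :: ratfun.
         A \<noteq> 0 \<and> homogeneous 0 A \<and> subst_rf A (varY, varX) = A \<and>
         conjugate_rm (varX * A, varY * A) \<phi> \<psi>))"
proof (intro conjI allI impI)
  show "\<forall>\<phi> \<in> {phi_tor1, Phi1, Phi1', Psi}. flow_level_one \<phi> \<and> i0_symmetric \<phi>"
    using phi_tor1_level_one phi_tor1_symmetric Phi1_level_one Phi1_symmetric
      Phi1'_level_one Phi1'_symmetric Psi_level_one Psi_symmetric by simp
next
  fix \<psi> assume \<psi>: "flow_level_one \<psi> \<and> i0_symmetric \<psi>"
  obtain u v where uv: "\<psi> = (u, v)" by (cases \<psi>)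
  obtain P Q where "one_BIR (P, Q)" "conjugate_rm (P, Q) phi_one (u, v)"
    using \<psi> unfolding uv flow_level_one_def by (metis prod.exhaust)
  from symmetric_level_one_classification[OF this] \<psi>
  show "\<exists>\<phi> \<in> {phi_tor1, Phi1, Phi1', Psi}. \<exists>A :: ratfun.
     A \<noteq> 0 \<and> homogeneous 0 A \<and> subst_rf A (varY, varX) = A \<and>
     conjugate_rm (varX * A, varY * A) \<phi> \<psi>"
    unfolding uv sigma_def subst_rf_def by auto
qed

end
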